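(* Let $d$ and $k$ be positive integers and let $\mu_1, \mu_2, \ldots, \mu_d$ be $d$ nice measures in $\mathbb{R}^d$ such that $\mu_i(\mathbb{R}^d) = k$ for all $1 \le i \le d$. Then there is a convex partition of $\mathbb{R}^d$ in sets $C_1, C_2, \ldots, C_k$ such that $\mu_i(C_j) = 1$ for all $1 \le i \le d$ and $1 \le j \le k$.
   Context: A nice measure in $\mathbb{R}^d$ is a finite measure $\mu$ on $\mathbb{R}^d$, absolutely continuous with respect to the Lebesgue measure, such that there is a bounded convex set $K \subset \mathbb{R}^d$ with $\mu(K) = \mu(\mathbb{R}^d)$ and $\mu$ is nonvanishing in open sets of $K$ (that is, $\mu(U) > 0$ for every nonempty relatively open subset $U$ of $K$). A convex partition $(C_1, \ldots, C_k)$ of $\mathbb{R}^d$ is a family of closed convex sets with pairwise disjoint interiors whose union is $\mathbb{R}^d$. *)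

theory Defs
  imports "HOL-Analysis.Analysis"
begin

text \<open>
  Measures on \<open>\<real>\<^sup>d\<close> are Borel measures. \<open>K\<close> need not be assumed Borel: the last conjunct (with \<open>U = K\<close>)
  rules out a non-Borel \<open>K\<close>, whose \<^const>\<open>emeasure\<close> is 0 by convention. Nothing is lost by
  this. If \<open>K\<close> is bounded and convex but not Borel and the conditions hold for the completion
  of \<open>\<mu>\<close>, then \<open>interior K\<close> satisfies them too, because the frontier of a convex set is a
  Lebesgue null set.
\<close>

definition nice_measure :: "(real ^ 'n) measure \<Rightarrow> bool" where
  "nice_measure \<mu> \<longleftrightarrow>
     sets \<mu> = sets borel \<and> finite_measure \<mu> \<and> absolutely_continuous lborel \<mu> \<and>
     (\<exists>K. bounded K \<and> convex K \<and> emeasure \<mu> K = emeasure \<mu> UNIV \<and>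
          (\<forall>U. openin (top_of_set K) U \<longrightarrow> U \<noteq> {} \<longrightarrow> emeasure \<mu> U > 0))"

definition convex_partition :: "nat \<Rightarrow> (nat \<Rightarrow> (real ^ 'n) set) \<Rightarrow> bool" where
  "convex_partition k C \<longleftrightarrow>
     (\<forall>j\<in>{1..k}. closed (C j) \<and> convex (C j)) \<and>
     disjoint_family_on (\<lambda>j. interior (C j)) {1..k} \<and>
     (\<Union>j\<in>{1..k}. C j) = UNIV"

end

theory Submission
  imports Defs "HOL-Number_Theory.Cong" "HOL-Library.Poly_Mapping" "HOL-Library.Sublist"
begin

text \<open>
  Induction on \<open>k\<close>. Let \<open>p\<close> be a prime divisor of \<open>k\<close>; it suffices to find a convex partition into pieces
  \<open>D\<^sub>j\<close> with \<open>\<mu>\<^sub>i(D\<^sub>j) = n\<^sub>j k / p\<close> for all \<open>i\<close>, where the \<open>n\<^sub>j < p\<close> are positive integers with sum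
  \<open>p\<close>, since the induction hypothesis then applies to the measures restricted to \<open>D\<^sub>j\<close>.
  To \<open>p\<close> affine functions \<open>u\<^sub>1, \<dots>, u\<^sub>p\<close> belongs the soft partition of unity
  \<open>exp u\<^sub>k / (exp u\<^sub>1 + \<dots> + exp u\<^sub>p)\<close>. It depends continuously on the functions, even where some of them
  coincide, and it is equivariant under cyclic permutations. A Borsuk--Ulam theorem for \<open>\<int>/p\<close> therefore yields,
  for arbitrarily large differences of the \<open>u\<^sub>k\<close>, soft partitions that are arbitrarily close to equipartitions
  of all \<open>d\<close> measures. In the limit, functions whose mutual differences stay bounded are
  merged into one class, differences between classes become \<open>\<plusminus>\<infinity>\<close> off a hyperplane, and the soft
  partition becomes a convex partition whose pieces correspond to the at least two classes.

  The Borsuk--Ulam theorem for maps from a join of \<open>d (p - 1) + 1\<close> copies of \<open>\<int>/p\<close> is reduced to a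
  Tucker-type lemma by iterated barycentric subdivision. That lemma compares the chains of
  the join with the periodic resolution of \<open>\<int>/p\<close>: explicit cochains of \<open>\<int>/p\<close>, summed over
  all rotations, take a value congruent to 1 modulo \<open>p\<close> on the top chain, but vanish on every list with two
  equal neighbours.
\<close>

subsection \<open>Chains of lists\<close>

lemma frag_extend_frag_extend:
  "frag_extend f (frag_extend g c) = frag_extend (\<lambda>x. frag_extend f (g x)) c"
  using subset_UNIV by (induction c rule: frag_induction) (auto simp: frag_extend_diff)

text \<open>Evaluation of a cochain on a chain. The detour through the free abelian group on one
  generator reduces linearity to the rules for \<open>frag_extend\<close>.\<close>

definition frag_eval :: "('a \<Rightarrow> int) \<Rightarrow> ('a \<Rightarrow>\<^sub>0 int) \<Rightarrow> int" where
  "frag_eval \<phi> c = Poly_Mapping.lookup (frag_extend (\<lambda>x. frag_cmul (\<phi> x) (frag_of ())) c) ()"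

lemma frag_eval_0 [simp]: "frag_eval \<phi> 0 = 0"
  and frag_eval_of [simp]: "frag_eval \<phi> (frag_of x) = \<phi> x"
  and frag_eval_diff: "frag_eval \<phi> (c - d) = frag_eval \<phi> c - frag_eval \<phi> d"
  and frag_eval_add: "frag_eval \<phi> (c + d) = frag_eval \<phi> c + frag_eval \<phi> d"
  by (simp_all add: frag_eval_def frag_extend_diff frag_extend_add lookup_minus lookup_add)

lemma frag_eval_sum: "finite I \<Longrightarrow> frag_eval \<phi> (\<Sum>i\<in>I. c i) = (\<Sum>i\<in>I. frag_eval \<phi> (c i))"
  by (simp add: frag_eval_def frag_extend_sum lookup_sum)

lemma frag_eval_cong:
  "(\<And>x. x \<in> Poly_Mapping.keys c \<Longrightarrow> \<phi> x = \<psi> x) \<Longrightarrow> frag_eval \<phi> c = frag_eval \<psi> c"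
  unfolding frag_eval_def by (metis (mono_tags, lifting) frag_extend_eq)

lemma frag_eval_frag_extend: "frag_eval \<phi> (frag_extend f c) = frag_eval (\<lambda>x. frag_eval \<phi> (f x)) c"
  using subset_UNIV by (induction c rule: frag_induction) (auto simp: frag_extend_diff frag_eval_diff)

lemma frag_eval_mult: "frag_eval (\<lambda>x. k * \<phi> x) c = k * frag_eval \<phi> c"
  using subset_UNIV
  by (induction c rule: frag_induction) (auto simp: frag_eval_diff right_diff_distrib)

lemma frag_eval_zero [simp]: "frag_eval (\<lambda>_. 0) c = 0"
  using frag_eval_mult[of 0 "\<lambda>_. 0" c] by simp

lemma frag_eval_fun_diff: "frag_eval (\<lambda>x. \<phi> x - \<psi> x) c = frag_eval \<phi> c - frag_eval \<psi> c"
  using subset_UNIV by (induction c rule: frag_induction) (auto simp: frag_eval_diff)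

lemma frag_eval_fun_sum:
  "frag_eval (\<lambda>x. \<Sum>i\<in>I. \<phi> i x) c = (\<Sum>i\<in>I. frag_eval (\<phi> i) c)"
  using subset_UNIV
  by (induction c rule: frag_induction) (auto simp: frag_eval_diff sum_subtractf)

section \<open>Cones, boundaries and induced chain maps\<close>

definition cone_chain :: "'a \<Rightarrow> ('a list \<Rightarrow>\<^sub>0 int) \<Rightarrow> 'a list \<Rightarrow>\<^sub>0 int" where
  "cone_chain v = frag_extend (\<lambda>xs. frag_of (v # xs))"

lemma cone_of [simp]: "cone_chain v (frag_of xs) = frag_of (v # xs)"
  and cone_0 [simp]: "cone_chain v 0 = 0"
  and cone_diff: "cone_chain v (c - d) = cone_chain v c - cone_chain v d"
  by (simp_all add: cone_chain_def frag_extend_diff)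

lemma keys_cone: "Poly_Mapping.keys (cone_chain v c) \<subseteq> (#) v ` Poly_Mapping.keys c"
  using keys_frag_extend[of "\<lambda>xs. frag_of (v # xs)" c] by (auto simp: cone_chain_def keys_frag_of)

lemma frag_eval_cone: "frag_eval \<phi> (cone_chain v c) = frag_eval (\<lambda>xs. \<phi> (v # xs)) c"
  by (simp add: cone_chain_def frag_eval_frag_extend)

text \<open>The chain complex is augmented: the empty list spans degree \<open>-1\<close>.\<close>

primrec face_sum :: "'a list \<Rightarrow> 'a list \<Rightarrow>\<^sub>0 int" where
  "face_sum [] = 0"
| "face_sum (v # xs) = frag_of xs - cone_chain v (face_sum xs)"

definition bdry :: "('a list \<Rightarrow>\<^sub>0 int) \<Rightarrow> 'a list \<Rightarrow>\<^sub>0 int" where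
  "bdry = frag_extend face_sum"

lemma bdry_of [simp]: "bdry (frag_of xs) = face_sum xs"
  and bdry_0 [simp]: "bdry 0 = 0"
  and bdry_diff: "bdry (c - d) = bdry c - bdry d"
  and bdry_sum: "finite I \<Longrightarrow> bdry (\<Sum>i\<in>I. e i) = (\<Sum>i\<in>I. bdry (e i))"
  by (simp_all add: bdry_def frag_extend_diff frag_extend_sum)

text \<open>Coning is a contracting homotopy of the augmented complex. Hence the cone over a cycle
  has that cycle as its boundary, which is the source of all fillings below.\<close>

lemma bdry_cone: "bdry (cone_chain v c) = c - cone_chain v (bdry c)"
  using subset_UNIV
  by (induction c rule: frag_induction) (auto simp: bdry_diff cone_diff)

lemma bdry_face_sum: "bdry (face_sum xs) = 0"
  by (induction xs) (auto simp: bdry_diff bdry_cone)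

lemma keys_face_sum:
  "ys \<in> Poly_Mapping.keys (face_sum xs) \<Longrightarrow> subseq ys xs \<and> Suc (length ys) = length xs"
proof (induction xs arbitrary: ys)
  case (Cons v xs)
  then have "ys = xs \<or> ys \<in> (#) v ` Poly_Mapping.keys (face_sum xs)"
    using keys_diff[of "frag_of xs" "cone_chain v (face_sum xs)"] keys_cone[of v "face_sum xs"]
    by (auto simp: keys_frag_of)
  with Cons.IH show ?case by auto
qed auto

text \<open>Lists with repeated entries are kept, not set to zero, so every map of vertices induces
  a chain map. Degenerate lists are dealt with by the cochains instead.\<close>

definition chain_map :: "('a \<Rightarrow> 'b) \<Rightarrow> ('a list \<Rightarrow>\<^sub>0 int) \<Rightarrow> 'b list \<Rightarrow>\<^sub>0 int" where
  "chain_map f = frag_extend (frag_of \<circ> map f)"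

lemma chain_map_of [simp]: "chain_map f (frag_of xs) = frag_of (map f xs)"
  and chain_map_0 [simp]: "chain_map f 0 = 0"
  and chain_map_diff: "chain_map f (c - d) = chain_map f c - chain_map f d"
  and chain_map_sum: "finite I \<Longrightarrow> chain_map f (\<Sum>i\<in>I. e i) = (\<Sum>i\<in>I. chain_map f (e i))"
  by (simp_all add: chain_map_def frag_extend_diff frag_extend_sum)

lemma keys_chain_map: "Poly_Mapping.keys (chain_map f c) \<subseteq> map f ` Poly_Mapping.keys c"
  using keys_frag_extend[of "frag_of \<circ> map f" c] by (auto simp: chain_map_def keys_frag_of)

lemma chain_map_cone: "chain_map f (cone_chain v c) = cone_chain (f v) (chain_map f c)"
  using subset_UNIV by (induction c rule: frag_induction) (auto simp: chain_map_diff cone_diff)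

lemma chain_map_compose: "chain_map f (chain_map g c) = chain_map (f \<circ> g) c"
  using subset_UNIV
  by (induction c rule: frag_induction) (auto simp: chain_map_diff comp_def)

lemma bdry_chain_map: "bdry (chain_map f c) = chain_map f (bdry c)"
proof -
  have *: "face_sum (map f xs) = chain_map f (face_sum xs)" for xs
    by (induction xs) (auto simp: chain_map_diff chain_map_cone)
  show ?thesis
    using subset_UNIV
    by (induction c rule: frag_induction) (auto simp: chain_map_diff bdry_diff *)
qed

lemma frag_eval_chain_map: "frag_eval \<phi> (chain_map f c) = frag_eval (\<lambda>xs. \<phi> (map f xs)) c"
  by (simp add: chain_map_def frag_eval_frag_extend)

subsection \<open>The resolution of a cyclic group\<close>

text \<open>The differentials of the periodic resolution of the cyclic group of order \<open>p\<close>.\<close>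

definition cyc_diff :: "nat \<Rightarrow> ('a \<Rightarrow> 'a) \<Rightarrow> nat \<Rightarrow> ('a list \<Rightarrow>\<^sub>0 int) \<Rightarrow> 'a list \<Rightarrow>\<^sub>0 int" where
  "cyc_diff p g q c = (if even q then chain_map g c - c else (\<Sum>k<p. chain_map (g ^^ k) c))"

text \<open>Since \<open>g ^^ p = id\<close>, the sum over all rotations does not change under one
  more rotation. So it composes to zero with \<open>g\<close> minus the identity, in either
  order.\<close>

lemma cyc_diff_cyc_diff:
  assumes "g ^^ p = id"
  shows "cyc_diff p g (Suc q) (cyc_diff p g q c) = 0"
proof -
  have *: "(\<Sum>k<p. chain_map (g ^^ Suc k) c) = (\<Sum>k<p. chain_map (g ^^ k) c)"
  proof -
    have "(\<Sum>k<Suc p. chain_map (g ^^ k) c) = chain_map id c + (\<Sum>k<p. chain_map (g ^^ Suc k) c)"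
      by (subst sum.lessThan_Suc_shift) (simp add: id_def)
    moreover have "(\<Sum>k<Suc p. chain_map (g ^^ k) c) = (\<Sum>k<p. chain_map (g ^^ k) c) + chain_map id c"
      using assms by simp
    ultimately show ?thesis by simp
  qed
  show ?thesis
  proof (cases "even q")
    case True
    then show ?thesis
      using * by (simp add: cyc_diff_def chain_map_diff chain_map_compose sum_subtractf funpow_Suc_right del: funpow.simps)
  next
    case False
    then show ?thesis
      using * by (simp add: cyc_diff_def chain_map_sum chain_map_compose)
  qed
qed

lemma bdry_cyc_diff: "bdry (cyc_diff p g q c) = cyc_diff p g q (bdry c)"
  by (simp add: cyc_diff_def bdry_diff bdry_sum bdry_chain_map)

lemma keys_cyc_diff:
  assumes "xs \<in> Poly_Mapping.keys (cyc_diff p g q c)" 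
  obtains k ys where "ys \<in> Poly_Mapping.keys c" "xs = map (g ^^ k) ys"
proof (cases "even q")
  case True
  with assms have "xs \<in> Poly_Mapping.keys (chain_map g c) \<union> Poly_Mapping.keys c"
    using keys_diff[of "chain_map g c" c] by (auto simp: cyc_diff_def)
  then show ?thesis
    using keys_chain_map[of g c] that[of _ 1] that[of _ 0] by auto
next
  case False
  with assms have "xs \<in> (\<Union>k<p. Poly_Mapping.keys (chain_map (g ^^ k) c))"
    using keys_sum[of "\<lambda>k. chain_map (g ^^ k) c" "{..<p}"] by (auto simp: cyc_diff_def)
  then show ?thesis
    using keys_chain_map[of _ c] that by blast
qed

text \<open>The cochain \<open>(a, b) \<mapsto> of_bool (b < a)\<close> on \<open>\<int>/p\<close> has the carry cocycle as its coboundary;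
  \<open>carry_prod\<close> is a cup power of this cocycle. Its cup products with \<open>a \<mapsto> of_bool (a = p - 1)\<close> and with the
  cochain itself are \<open>cocyc0\<close> and \<open>cocyc1\<close>, the components of the comparison map to the
  periodic resolution in even and odd degrees.\<close>

fun carry_prod :: "nat list \<Rightarrow> int" where
  "carry_prod [] = 0"
| "carry_prod [a] = 1"
| "carry_prod [a, b] = 0"
| "carry_prod (a # b # c # xs) =
     (of_bool (c < b) - of_bool (c < a) + of_bool (b < a)) * carry_prod (c # xs)"

fun cocyc0 :: "nat \<Rightarrow> nat list \<Rightarrow> int" where
  "cocyc0 p [] = 0"
| "cocyc0 p (a # xs) = of_bool (a = p - 1) * carry_prod (a # xs)"

fun cocyc1 :: "nat list \<Rightarrow> int" where
  "cocyc1 (a # b # xs) = of_bool (b < a) * carry_prod (b # xs)"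
| "cocyc1 _ = 0"

text \<open>A cup power of a cocycle is a cocycle. After the induction hypothesis is applied to the
  list without its first two entries, the coefficients in front of the common tail are those of the
  coboundary of a coboundary.\<close>

lemma frag_eval_carry_prod_face_sum:
  "even (length xs) \<Longrightarrow> xs \<noteq> [] \<Longrightarrow> frag_eval carry_prod (face_sum xs) = 0"
proof (induction xs rule: carry_prod.induct)
  case (4 a b c xs)
  obtain e r where xs: "xs = e # r"
    using "4.prems" by (cases xs) auto
  have "frag_eval carry_prod (face_sum (c # e # r)) = 0"
    using 4 xs by auto
  then have *: "frag_eval (\<lambda>ys. carry_prod (c # ys)) (face_sum (e # r)) = carry_prod (e # r)"
    by (simp only: face_sum.simps(2)[of c] frag_eval_diff frag_eval_of frag_eval_cone)
  show ?case
    unfolding xs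
    by (subst face_sum.simps(2), subst face_sum.simps(2), subst face_sum.simps(2))
       (simp del: face_sum.simps(2) add: frag_eval_diff frag_eval_cone cone_diff frag_eval_mult * frag_eval_add algebra_simps)
qed (auto simp: frag_eval_diff)

lemma frag_eval_carry_prod_Cons:
  assumes "odd (length xs)"
  shows "frag_eval (\<lambda>ys. carry_prod (a # ys)) (face_sum xs) = carry_prod xs"
  using frag_eval_carry_prod_face_sum[of "a # xs"] assms
  by (simp add: frag_eval_diff frag_eval_cone)

text \<open>Leibniz rule: as \<open>carry_prod\<close> is a cocycle, only the factor
  \<open>of_bool (a = p - 1)\<close> contributes.\<close>

lemma frag_eval_cocyc0_face_sum:
  assumes "odd (length xs)"
  shows "frag_eval (cocyc0 p) (face_sum (a # xs)) =
    (of_bool (hd xs = p - 1) - of_bool (a = p - 1)) * carry_prod xs"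
proof (cases xs)
  case (Cons b r)
  with assms show ?thesis
    by (simp del: face_sum.simps add: face_sum.simps(2)[of a] frag_eval_diff frag_eval_cone frag_eval_mult
        frag_eval_carry_prod_Cons left_diff_distrib)
qed (use assms in simp)

text \<open>Leibniz rule again: the coboundary of \<open>of_bool (b < a)\<close> is the carry
  cocycle, and its product with \<open>carry_prod\<close> is the next cup power.\<close>

lemma frag_eval_cocyc1_face_sum:
  assumes "odd (length xs)"
  shows "frag_eval cocyc1 (face_sum (a # b # xs)) = carry_prod (a # b # xs)"
proof (cases xs)
  case (Cons c r)
  show ?thesis
    unfolding Cons using assms Cons
    by (subst face_sum.simps(2), subst face_sum.simps(2))
       (simp del: face_sum.simps add: frag_eval_diff frag_eval_cone cone_diff frag_eval_mult
        frag_eval_carry_prod_Cons frag_eval_add algebra_simps)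
qed (use assms in simp)

text \<open>The cochains are normalised: the coefficient of \<open>a # b # c # xs\<close> cancels to
  0 as soon as \<open>a = b\<close> or \<open>b = c\<close>.\<close>

lemma not_distinct_adj_carry_prod: "\<not> distinct_adj xs \<Longrightarrow> carry_prod xs = 0"
proof (induction xs rule: carry_prod.induct)
  case (4 a b c xs)
  then show ?case by (cases "a = b"; cases "b = c") auto
qed auto

lemma not_distinct_adj_cocyc0: "\<not> distinct_adj xs \<Longrightarrow> cocyc0 p xs = 0"
  by (cases xs) (auto simp: not_distinct_adj_carry_prod)

lemma not_distinct_adj_cocyc1: "\<not> distinct_adj xs \<Longrightarrow> cocyc1 xs = 0"
  by (cases xs rule: cocyc1.cases) (auto simp: not_distinct_adj_carry_prod)

section \<open>The rotation of the residues modulo \<open>p\<close> and its effect on the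
  cochains\<close>

definition shift :: "nat \<Rightarrow> nat \<Rightarrow> nat" where
  "shift p k = (if k < p then (k + 1) mod p else k)"

lemma shift_less [simp]: "k < p \<Longrightarrow> shift p k < p"
  by (simp add: shift_def)

lemma shift_eq: "k < p \<Longrightarrow> shift p k = (if k = p - 1 then 0 else k + 1)"
  by (auto simp: shift_def)

lemma shift_pow: "k < p \<Longrightarrow> (shift p ^^ m) k = (k + m) mod p"
  by (induction m) (auto simp: shift_def mod_Suc_eq)

lemma shift_pow_ge: "k \<ge> p \<Longrightarrow> (shift p ^^ m) k = k"
  by (induction m) (auto simp: shift_def)

text \<open>An identity of total functions, because \<open>shift p\<close> fixes everything from
  \<open>p\<close> on.\<close>

lemma shift_pow_period: "shift p ^^ p = id"
  by (metis eq_id_iff linorder_not_le mod_add_self2 mod_less shift_pow shift_pow_ge)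

text \<open>A rotation changes \<open>of_bool (b < a)\<close> by the coboundary of
  \<open>of_bool (a = p - 1)\<close>; its own coboundary, the carry cocycle, is therefore
  invariant.\<close>

lemma carry_prod_shift:
  "set xs \<subseteq> {..<p} \<Longrightarrow> carry_prod (map (shift p) xs) = carry_prod xs"
proof (induction xs rule: carry_prod.induct)
  case (4 a b c xs)
  have "(of_bool (shift p c < shift p b) - of_bool (shift p c < shift p a) + of_bool (shift p b < shift p a) :: int)
    = of_bool (c < b) - of_bool (c < a) + of_bool (b < a)"
    using 4 by (auto simp: shift_eq of_bool_def)
  with 4 show ?case by simp
qed auto

lemma carry_prod_shift_pow:
  "set xs \<subseteq> {..<p} \<Longrightarrow> carry_prod (map (shift p ^^ k) xs) = carry_prod xs"
proof (induction k)
  case (Suc k)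
  have "carry_prod (map (shift p) (map (shift p ^^ k) xs)) = carry_prod (map (shift p ^^ k) xs)"
    using Suc.prems by (intro carry_prod_shift) (auto simp: shift_pow subset_iff)
  with Suc show ?case by (simp add: comp_def)
qed simp

text \<open>The right-hand side is the coboundary of \<open>cocyc0\<close> found in
  \<open>frag_eval_cocyc0_face_sum\<close>. This match links even degrees to odd ones.\<close>

lemma cocyc1_shift:
  assumes "set (a # b # xs) \<subseteq> {..<p}"
  shows "cocyc1 (map (shift p) (a # b # xs)) - cocyc1 (a # b # xs)
    = (of_bool (b = p - 1) - of_bool (a = p - 1)) * carry_prod (b # xs)"
proof -
  have "(of_bool (shift p b < shift p a) - of_bool (b < a) :: int) = of_bool (b = p - 1) - of_bool (a = p - 1)"
    using assms by (auto simp: shift_eq of_bool_def)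
  then show ?thesis
    using carry_prod_shift[of "b # xs" p] assms by (simp flip: left_diff_distrib)
qed

text \<open>Exactly one rotation, by \<open>p - 1 - a\<close>, moves the first entry
  \<open>a\<close> to \<open>p - 1\<close>.\<close>

lemma sum_cocyc0_shift:
  assumes "set xs \<subseteq> {..<p}" "xs \<noteq> []"
  shows "(\<Sum>k<p. cocyc0 p (map (shift p ^^ k) xs)) = carry_prod xs"
proof -
  obtain a ys where xs: "xs = a # ys" using assms by (cases xs) auto
  then have a: "a < p" using assms by auto
  have "(\<Sum>k<p. cocyc0 p (map (shift p ^^ k) xs)) = (\<Sum>k<p. of_bool (k = p - 1 - a) * carry_prod xs)"
  proof (rule sum.cong)
    fix k assume "k \<in> {..<p}"
    then have k: "k < p" by simp
    have "(a + k) mod p = p - 1 \<longleftrightarrow> k = p - 1 - a"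
    proof (cases "a + k < p")
      case False
      then have "(a + k) mod p = a + k - p" using a k by (simp add: mod_if)
      with False a k show ?thesis by auto
    qed (use a k in auto)
    then show "cocyc0 p (map (shift p ^^ k) xs) = of_bool (k = p - 1 - a) * carry_prod xs"
      using carry_prod_shift_pow[OF assms(1), of k] a by (simp add: xs shift_pow)
  qed simp
  also have "\<dots> = carry_prod xs"
    using a by (simp add: of_bool_def flip: sum_distrib_right)
  finally show ?thesis .
qed

text \<open>The value of the comparison cochain \<open>th q\<close> on \<open>y q\<close>, summed
  over all rotations, stays congruent to 1 modulo \<open>p\<close> as \<open>q\<close> grows. It
  would be 0 in degree \<open>n\<close> if every list there had equal neighbours.\<close>

lemma cyclic_chain_distinct_adj:
  fixes y :: "nat \<Rightarrow> nat list \<Rightarrow>\<^sub>0 int"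
  assumes p: "p > 1"
    and keys: "\<And>q xs. q \<le> n \<Longrightarrow> xs \<in> Poly_Mapping.keys (y q) \<Longrightarrow> length xs = Suc q \<and> set xs \<subseteq> {..<p}"
    and y0: "bdry (y 0) = frag_of []"
    and ySuc: "\<And>q. q < n \<Longrightarrow> bdry (y (Suc q)) = cyc_diff p (shift p) q (y q)"
  shows "\<exists>xs \<in> Poly_Mapping.keys (y n). distinct_adj xs"
proof (rule ccontr)
  assume neg: "\<not> ?thesis"
  define th where "th q = (if even q then cocyc0 p else cocyc1)" for q :: nat
  define A where "A q k = frag_eval (th q) (chain_map (shift p ^^ k) (y q))" for q k
  have keys': "length xs = Suc q \<and> set xs \<subseteq> {..<p}"
    if "xs \<in> Poly_Mapping.keys (chain_map (shift p ^^ k) (y q))" "q \<le> n" for q k xs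
    using that keys[of q] keys_chain_map[of "shift p ^^ k" "y q"]
    by (fastforce simp: shift_pow subset_iff)
  \<comment> \<open>The coboundary of \<open>cocyc0\<close> is the change of \<open>cocyc1\<close>
    under one rotation.\<close>
  have even_step: "A q (Suc k) - A q k = A (Suc q) (Suc k) - A (Suc q) k" if "even q" "q < n" for q k
  proof -
    let ?c = "chain_map (shift p ^^ k) (y (Suc q))"
    have "A q (Suc k) - A q k = frag_eval (cocyc0 p) (chain_map (shift p ^^ k) (cyc_diff p (shift p) q (y q)))"
      using that by (simp add: A_def th_def cyc_diff_def chain_map_diff chain_map_compose frag_eval_diff funpow_Suc_right del: funpow.simps)
    also have "\<dots> = frag_eval (\<lambda>xs. frag_eval (cocyc0 p) (face_sum xs)) ?c"
      using that by (simp flip: ySuc bdry_chain_map) (simp add: bdry_def frag_eval_frag_extend)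
    also have "\<dots> = frag_eval (\<lambda>xs. cocyc1 (map (shift p) xs) - cocyc1 xs) ?c"
    proof (rule frag_eval_cong)
      fix xs assume "xs \<in> Poly_Mapping.keys ?c"
      then have xs: "length xs = Suc (Suc q)" "set xs \<subseteq> {..<p}"
        using keys' that by auto
      then obtain a b r where "xs = a # b # r"
        by (metis length_Suc_conv)
      then show "frag_eval (cocyc0 p) (face_sum xs) = cocyc1 (map (shift p) xs) - cocyc1 xs"
        using cocyc1_shift[of a b r p] frag_eval_cocyc0_face_sum[of "b # r" p a] xs that by simp
    qed
    also have "\<dots> = A (Suc q) (Suc k) - A (Suc q) k"
      using that by (simp add: A_def th_def frag_eval_fun_diff frag_eval_chain_map)
    finally show ?thesis .
  qed
  \<comment> \<open>The coboundary of \<open>cocyc1\<close> is \<open>carry_prod\<close>, which is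
    also the sum of \<open>cocyc0\<close> over all rotations.\<close>
  have odd_step: "(\<Sum>k<p. A q k) = (\<Sum>k<p. A (Suc q) k)" if "odd q" "q < n" for q
  proof -
    have "(\<Sum>k<p. A q k) = frag_eval cocyc1 (cyc_diff p (shift p) q (y q))"
      using that by (simp add: A_def th_def cyc_diff_def frag_eval_sum)
    also have "\<dots> = frag_eval (\<lambda>xs. frag_eval cocyc1 (face_sum xs)) (y (Suc q))"
      using that by (simp flip: ySuc) (simp add: bdry_def frag_eval_frag_extend)
    also have "\<dots> = frag_eval (\<lambda>xs. \<Sum>k<p. cocyc0 p (map (shift p ^^ k) xs)) (y (Suc q))"
    proof (rule frag_eval_cong)
      fix xs assume "xs \<in> Poly_Mapping.keys (y (Suc q))"
      then have xs: "length xs = Suc (Suc q)" "set xs \<subseteq> {..<p}"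
        using keys[of "Suc q"] that by auto
      then obtain a b r where ab: "xs = a # b # r"
        by (metis length_Suc_conv)
      then have "odd (length r)" using xs that by auto
      then show "frag_eval cocyc1 (face_sum xs) = (\<Sum>k<p. cocyc0 p (map (shift p ^^ k) xs))"
        using sum_cocyc0_shift[OF xs(2)] frag_eval_cocyc1_face_sum[of r a b] ab by simp
    qed
    also have "\<dots> = (\<Sum>k<p. A (Suc q) k)"
      using that by (simp add: A_def th_def frag_eval_fun_sum frag_eval_chain_map)
    finally show ?thesis .
  qed
  \<comment> \<open>By the even step this difference is the same for all \<open>k\<close>, so the
    sum over the \<open>p\<close> rotations changes by a multiple of \<open>p\<close>.\<close>
  have const: "A (Suc q) k - A q k = A (Suc q) 0 - A q 0" if "even q" "q < n" for q k
  proof (induction k)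
    case (Suc k)
    with even_step[OF that, of k] show ?case by simp
  qed simp
  have cong1: "[(\<Sum>k<p. A q k) = 1] (mod int p)" if "q \<le> n" for q
    using that
  proof (induction q)
    case 0
    \<comment> \<open>In degree 0 the sum is the augmentation of \<open>y 0\<close>, and this is 1
      by \<open>y0\<close>.\<close>
    have "(\<Sum>k<p. A 0 k) = frag_eval (\<lambda>xs. \<Sum>k<p. cocyc0 p (map (shift p ^^ k) xs)) (y 0)"
      by (simp add: A_def th_def frag_eval_fun_sum frag_eval_chain_map)
    also have "\<dots> = frag_eval (\<lambda>xs. frag_eval (\<lambda>_. 1) (face_sum xs)) (y 0)"
    proof (rule frag_eval_cong)
      fix xs assume "xs \<in> Poly_Mapping.keys (y 0)"
      then have xs: "length xs = Suc 0" "set xs \<subseteq> {..<p}"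
        using keys[of 0] by auto
      then obtain a where "xs = [a]"
        by (metis length_0_conv length_Suc_conv)
      then show "(\<Sum>k<p. cocyc0 p (map (shift p ^^ k) xs)) = frag_eval (\<lambda>_. 1) (face_sum xs)"
        using sum_cocyc0_shift[OF xs(2)] by simp
    qed
    also have "\<dots> = frag_eval (\<lambda>_. 1) (bdry (y 0))"
      by (simp add: bdry_def frag_eval_frag_extend)
    finally show ?case by (simp add: y0)
  next
    case (Suc q)
    then have IH: "[(\<Sum>k<p. A q k) = 1] (mod int p)" by simp
    show ?case
    proof (cases "even q")
      case True
      have "(\<Sum>k<p. A (Suc q) k) = (\<Sum>k<p. A q k + (A (Suc q) 0 - A q 0))"
        using const[OF True] Suc.prems by (intro sum.cong) (auto simp: frag_eval_add algebra_simps)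
      also have "\<dots> = (\<Sum>k<p. A q k) + int p * (A (Suc q) 0 - A q 0)"
        by (simp add: sum.distrib)
      finally show ?thesis
        using IH by (simp add: cong_def)
    next
      case False
      then show ?thesis using odd_step[of q] IH Suc.prems by simp
    qed
  qed
  have "A n k = 0" for k
  proof -
    \<comment> \<open>The constant is written as a product so that \<open>frag_eval_mult\<close>
      applies.\<close>
    have "A n k = frag_eval (\<lambda>_. 0 * 0) (chain_map (shift p ^^ k) (y n))"
      unfolding A_def
    proof (rule frag_eval_cong)
      fix xs assume "xs \<in> Poly_Mapping.keys (chain_map (shift p ^^ k) (y n))"
      then obtain ys where ys: "ys \<in> Poly_Mapping.keys (y n)" "xs = map (shift p ^^ k) ys"
        using keys_chain_map by blast
      then have "\<not> distinct_adj ys" using neg by auto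
      then have "\<not> distinct_adj xs"
        unfolding ys(2) by (meson distinct_adj_mapD)
      then show "th n xs = 0 * 0"
        by (simp add: th_def not_distinct_adj_cocyc0 not_distinct_adj_cocyc1)
    qed
    then show ?thesis by (simp only: frag_eval_mult)
  qed
  with cong1[of n] p show False
    by (simp add: cong_def)
qed

subsection \<open>Subdivision\<close>

lemma subseq_set: "subseq xs ys \<Longrightarrow> set xs \<subseteq> set ys"
  by (induction rule: list_emb.induct) auto

text \<open>The counter stands for the length of the list and makes the recursion through the faces
  primitive.\<close>

primrec subdiv_aux :: "('a list \<Rightarrow> 'b) \<Rightarrow> nat \<Rightarrow> 'a list \<Rightarrow> 'b list \<Rightarrow>\<^sub>0 int" where
  "subdiv_aux a 0 xs = frag_of []"
| "subdiv_aux a (Suc n) xs = cone_chain (a xs) (frag_extend (subdiv_aux a n) (face_sum xs))"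

text \<open>Barycentric subdivision, with \<open>a xs\<close> in the role of the barycentre of the simplex \<open>xs\<close>.\<close>

definition subdiv :: "('a list \<Rightarrow> 'b) \<Rightarrow> ('a list \<Rightarrow>\<^sub>0 int) \<Rightarrow> 'b list \<Rightarrow>\<^sub>0 int" where
  "subdiv a = frag_extend (\<lambda>xs. subdiv_aux a (length xs) xs)"

lemma subdiv_0 [simp]: "subdiv a 0 = 0"
  and subdiv_Nil [simp]: "subdiv a (frag_of []) = frag_of []"
  and subdiv_diff: "subdiv a (c - d) = subdiv a c - subdiv a d"
  and subdiv_sum: "finite I \<Longrightarrow> subdiv a (\<Sum>i\<in>I. e i) = (\<Sum>i\<in>I. subdiv a (e i))"
  by (simp_all add: subdiv_def frag_extend_diff frag_extend_sum)

lemma subdiv_expand: "subdiv a c = frag_extend (\<lambda>xs. subdiv a (frag_of xs)) c"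
  by (simp add: subdiv_def)

lemma subdiv_of:
  assumes "xs \<noteq> []"
  shows "subdiv a (frag_of xs) = cone_chain (a xs) (subdiv a (face_sum xs))"
proof -
  obtain n where n: "length xs = Suc n" using assms by (cases xs) auto
  have "frag_extend (subdiv_aux a n) (face_sum xs) = subdiv a (face_sum xs)"
    unfolding subdiv_def using keys_face_sum[of _ xs] n by (intro frag_extend_eq) auto
  then show ?thesis using n by (simp add: subdiv_def)
qed

lemma bdry_expand: "bdry (frag_extend f c) = frag_extend (\<lambda>xs. bdry (f xs)) c"
  by (simp add: bdry_def frag_extend_frag_extend)

text \<open>By induction on the length, the subdivided boundary of a simplex is a cycle, and so it
  is the boundary of the cone over it.\<close>

lemma bdry_subdiv:
  fixes a :: "'a list \<Rightarrow> 'b"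
  shows "bdry (subdiv a c) = subdiv a (bdry c)"
proof -
  have *: "bdry (subdiv a (frag_of xs)) = subdiv a (face_sum xs)" for xs :: "'a list"
  proof (induction xs rule: length_induct)
    case (1 xs)
    show ?case
    proof (cases "xs = []")
      case False
      have "bdry (subdiv a (face_sum xs)) = frag_extend (\<lambda>ys. bdry (subdiv a (frag_of ys))) (face_sum xs)"
        by (subst subdiv_expand) (rule bdry_expand)
      also have "\<dots> = frag_extend (\<lambda>ys. subdiv a (face_sum ys)) (face_sum xs)"
        using 1 keys_face_sum[of _ xs] by (intro frag_extend_eq) (metis lessI)
      also have "\<dots> = subdiv a (bdry (face_sum xs))"
        by (simp add: bdry_def subdiv_def frag_extend_frag_extend)
      finally have "bdry (subdiv a (face_sum xs)) = 0"
        by (simp add: bdry_face_sum)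
      with False show ?thesis by (simp add: subdiv_of bdry_cone)
    qed simp
  qed
  have "bdry (subdiv a c) = frag_extend (\<lambda>xs. bdry (subdiv a (frag_of xs))) c"
    by (subst subdiv_expand) (rule bdry_expand)
  also have "\<dots> = frag_extend (\<lambda>xs. subdiv a (face_sum xs)) c"
    by (simp only: *)
  also have "\<dots> = subdiv a (bdry c)"
    by (simp add: bdry_def subdiv_def frag_extend_frag_extend)
  finally show ?thesis .
qed

text \<open>The simplices of a barycentric subdivision are flags of faces, here with the largest
  face first. The count in \<open>tucker_cyclic\<close> and the mesh bound in
  \<open>keys_fine_chain\<close> both rest on this nesting.\<close>

lemma keys_subdiv_of:
  assumes "ys \<in> Poly_Mapping.keys (subdiv a (frag_of xs))"
  shows "\<exists>zs. ys = map a zs \<and> length zs = length xs \<and> (\<forall>z\<in>set zs. z \<noteq> [] \<and> subseq z xs)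
    \<and> sorted_wrt (\<lambda>u v. subseq v u) zs"
  using assms
proof (induction xs arbitrary: ys rule: length_induct)
  case (1 xs)
  show ?case
  proof (cases "xs = []")
    case True
    with 1 show ?thesis by (auto simp: keys_frag_of)
  next
    case False
    then obtain ys' where ys: "ys = a xs # ys'" and "ys' \<in> Poly_Mapping.keys (subdiv a (face_sum xs))"
      using 1 keys_cone[of "a xs" "subdiv a (face_sum xs)"] by (auto simp: subdiv_of)
    then obtain xs' where xs': "xs' \<in> Poly_Mapping.keys (face_sum xs)"
      "ys' \<in> Poly_Mapping.keys (subdiv a (frag_of xs'))"
      by (subst (asm) subdiv_expand) (use keys_frag_extend in fastforce)
    then have sub: "subseq xs' xs" "Suc (length xs') = length xs"
      using keys_face_sum by auto
    then obtain zs where "ys' = map a zs" "length zs = length xs'"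
      "\<forall>z\<in>set zs. z \<noteq> [] \<and> subseq z xs'" "sorted_wrt (\<lambda>u v. subseq v u) zs"
      using 1 xs' by (metis lessI)
    with sub ys False show ?thesis
      by (intro exI[of _ "xs # zs"]) (auto intro: subseq_order.order_trans)
  qed
qed

lemma keys_subdiv:
  assumes "ys \<in> Poly_Mapping.keys (subdiv a c)"
  obtains xs zs where "xs \<in> Poly_Mapping.keys c" "ys = map a zs" "length zs = length xs"
    "\<And>z. z \<in> set zs \<Longrightarrow> z \<noteq> [] \<and> subseq z xs" "sorted_wrt (\<lambda>u v. subseq v u) zs"
proof -
  obtain xs where "xs \<in> Poly_Mapping.keys c" "ys \<in> Poly_Mapping.keys (subdiv a (frag_of xs))"
    using assms by (subst (asm) subdiv_expand) (use keys_frag_extend in fastforce)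
  with keys_subdiv_of[of ys a xs] that show ?thesis by blast
qed

text \<open>Naturality of subdivision. The labels have to be compatible only on faces of lists that
  occur in \<open>c\<close>; in \<open>tucker_cyclic\<close> equivariance is known just for
  those.\<close>

lemma subdiv_chain_map:
  assumes "\<And>xs z. xs \<in> Poly_Mapping.keys c \<Longrightarrow> subseq z xs \<Longrightarrow> z \<noteq> [] \<Longrightarrow> a' (map f z) = h (a z)"
  shows "subdiv a' (chain_map f c) = chain_map h (subdiv a c)"
proof -
  have expand: "subdiv a' (chain_map f c) = frag_extend (\<lambda>xs. subdiv a' (frag_of (map f xs))) c"
    "chain_map h (subdiv a c) = frag_extend (\<lambda>xs. chain_map h (subdiv a (frag_of xs))) c" for c
    by (simp_all add: subdiv_def chain_map_def frag_extend_frag_extend)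
  have *: "subdiv a' (frag_of (map f xs)) = chain_map h (subdiv a (frag_of xs))"
    if "\<And>z. subseq z xs \<Longrightarrow> z \<noteq> [] \<Longrightarrow> a' (map f z) = h (a z)" for xs
    using that
  proof (induction xs rule: length_induct)
    case (1 xs)
    have "frag_extend (\<lambda>xs. subdiv a' (frag_of (map f xs))) (face_sum xs)
      = frag_extend (\<lambda>xs. chain_map h (subdiv a (frag_of xs))) (face_sum xs)"
    proof (rule frag_extend_eq)
      fix ys assume "ys \<in> Poly_Mapping.keys (face_sum xs)"
      then have "subseq ys xs" "length ys < length xs"
        using keys_face_sum by force+
      then show "subdiv a' (frag_of (map f ys)) = chain_map h (subdiv a (frag_of ys))"
        using 1(1) 1(2) by (blast intro: subseq_order.order_trans)
    qed
    then have "subdiv a' (chain_map f (face_sum xs)) = chain_map h (subdiv a (face_sum xs))"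
      by (rule trans[OF expand(1) trans[OF _ expand(2)[symmetric]]])
    moreover have "face_sum (map f xs) = chain_map f (face_sum xs)"
      using bdry_chain_map[of f "frag_of xs"] by simp
    ultimately show ?case
      using 1 by (cases "xs = []") (auto simp: subdiv_of chain_map_cone)
  qed
  show ?thesis
  proof (rule trans[OF expand(1) trans[OF frag_extend_eq expand(2)[symmetric]]])
    fix xs assume "xs \<in> Poly_Mapping.keys c"
    then show "subdiv a' (frag_of (map f xs)) = chain_map h (subdiv a (frag_of xs))"
      by (intro * assms)
  qed
qed

subsection \<open>A Tucker lemma for cyclic groups of prime order\<close>

text \<open>These are the nonempty simplices of the join of \<open>d\<close> copies of the boundary
  of the simplex on \<open>{..<p}\<close>.\<close>

definition admissible :: "nat \<Rightarrow> nat \<Rightarrow> (nat \<times> nat) set \<Rightarrow> bool" where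
  "admissible d p A \<longleftrightarrow> A \<noteq> {} \<and> A \<subseteq> {..<d} \<times> {..<p} \<and> (\<forall>i<d. \<not> {i} \<times> {..<p} \<subseteq> A)"

lemma admissible_finite: "admissible d p A \<Longrightarrow> finite A"
  unfolding admissible_def by (meson finite_SigmaI finite_lessThan finite_subset)

text \<open>Each of the \<open>d\<close> blocks misses at least one element.\<close>

lemma card_admissible:
  assumes "admissible d p A"
  shows "card A \<le> d * (p - 1)"
proof -
  obtain m where m: "\<And>i. i < d \<Longrightarrow> m i < p \<and> (i, m i) \<notin> A"
    using assms unfolding admissible_def by (auto simp: subset_iff) metis
  have "A \<subseteq> (SIGMA i:{..<d}. {..<p} - {m i})"
    using assms m unfolding admissible_def by fastforce
  then have "card A \<le> card (SIGMA i:{..<d}. {..<p} - {m i})"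
    by (intro card_mono) auto
  also have "\<dots> = (\<Sum>i<d. p - 1)"
    using m by (simp add: card_SigmaI)
  finally show ?thesis by simp
qed

text \<open>An equivariant choice of a residue class: the mean of the first block. It exists because
  the number of elements of the block is invertible modulo \<open>p\<close>.\<close>

definition block_mean :: "nat \<Rightarrow> (nat \<times> nat) set \<Rightarrow> nat" where
  "block_mean p A = (let S = {j. (Min (fst ` A), j) \<in> A} in
     ((SOME u. [card S * u = 1] (mod p)) * \<Sum>S) mod p)"

lemma shift_inj: "inj_on (shift p) {..<p}"
  by (auto simp: inj_on_def shift_eq split: if_splits)

lemma shift_image: "p > 0 \<Longrightarrow> shift p ` {..<p} = {..<p}"
  by (simp add: endo_inj_surj shift_inj image_subset_iff)

lemma admissible_shift:
  assumes "admissible d p A" "p > 0"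
  shows "admissible d p (apsnd (shift p) ` A)"
  unfolding admissible_def
proof (intro conjI allI impI notI)
  fix i assume i: "i < d" and sub: "{i} \<times> {..<p} \<subseteq> apsnd (shift p) ` A"
  have "{i} \<times> {..<p} \<subseteq> A"
  proof clarify
    fix j assume j: "j < p"
    then have "(i, shift p j) \<in> apsnd (shift p) ` A" using sub by auto
    then obtain j' where "(i, j') \<in> A" "shift p j' = shift p j" by (auto simp: apsnd_def map_prod_def)
    moreover then have "j' < p" using assms by (auto simp: admissible_def)
    ultimately show "(i, j) \<in> A" using shift_inj[of p] j by (auto dest: inj_onD)
  qed
  then show False using assms i by (auto simp: admissible_def)
qed (use assms in \<open>auto simp: admissible_def\<close>)

text \<open>The rotation keeps the first block and \<open>card S\<close>, hence also the chosen
  inverse \<open>u\<close>. It adds \<open>card S\<close> to the sum of the block modulo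
  \<open>p\<close>, and multiplication by \<open>u\<close> turns this into 1.\<close>

lemma block_mean_shift:
  assumes p: "prime p" and A: "admissible d p A"
  shows "block_mean p (apsnd (shift p) ` A) = shift p (block_mean p A)"
proof -
  have p0: "p > 0" using p prime_gt_0_nat by blast
  define i where "i = Min (fst ` A)"
  define S where "S = {j. (i, j) \<in> A}"
  have "i \<in> fst ` A"
    unfolding i_def using A admissible_finite[OF A] by (intro Min_in) (auto simp: admissible_def)
  then have "S \<noteq> {}" "i < d" using A by (auto simp: S_def admissible_def)
  have Sp: "S \<subset> {..<p}"
    using A \<open>i < d\<close> by (auto simp: S_def admissible_def)
  then have "card S < p" "card S > 0"
    using psubset_card_mono[OF _ Sp] \<open>S \<noteq> {}\<close> finite_subset[of S "{..<p}"] by (auto simp: card_gt_0_iff)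
  then have "coprime (card S) p"
    using p by (metis coprime_commute nat_dvd_not_less prime_imp_coprime)
  define u where "u = (SOME u. [card S * u = 1] (mod p))"
  have u: "[card S * u = 1] (mod p)"
    using cong_solve_coprime_nat[OF \<open>coprime (card S) p\<close>]
    unfolding u_def One_nat_def by (rule someI_ex)
  have fst: "fst ` (apsnd (shift p) ` A) = fst ` A"
    by (auto simp: image_image)
  have S': "{j. (i, j) \<in> apsnd (shift p) ` A} = shift p ` S"
    by (force simp: S_def)
  have inj: "inj_on (shift p) S"
    using shift_inj Sp by (metis inj_on_subset psubset_imp_subset)
  have "[\<Sum>(shift p ` S) = (\<Sum>j\<in>S. j + 1)] (mod p)"
    unfolding sum.reindex[OF inj] comp_def id_def
    by (intro cong_sum) (use Sp in \<open>auto simp: shift_def cong_def\<close>)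
  moreover have "(\<Sum>j\<in>S. j + 1) = \<Sum>S + card S"
    by (subst sum.distrib) simp
  ultimately have "[\<Sum>(shift p ` S) = \<Sum>S + card S] (mod p)"
    by simp
  then have "[u * \<Sum>(shift p ` S) = u * \<Sum>S + card S * u] (mod p)"
    by (metis cong_scalar_left distrib_left mult.commute)
  also have "[u * \<Sum>S + card S * u = u * \<Sum>S + 1] (mod p)"
    using u by (intro cong_add cong_refl)
  finally have *: "[u * \<Sum>(shift p ` S) = u * \<Sum>S + 1] (mod p)" .
  have "block_mean p (apsnd (shift p) ` A) = (u * \<Sum>(shift p ` S)) mod p"
    unfolding block_mean_def fst i_def[symmetric] S' by (simp add: Let_def card_image[OF inj] u_def)
  also have "\<dots> = (u * \<Sum>S + 1) mod p"
    using * by (simp add: cong_def)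
  also have "\<dots> = shift p ((u * \<Sum>S) mod p)"
    using p0 by (simp add: shift_def mod_Suc_eq)
  also have "(u * \<Sum>S) mod p = block_mean p A"
    unfolding block_mean_def i_def[symmetric] S_def[symmetric] by (simp add: Let_def u_def)
  finally show ?thesis .
qed

text \<open>Neighbours differ, so the cardinality drops at each step, and the last set still has an
  element.\<close>

lemma length_decreasing_sets:
  assumes "sorted_wrt (\<supseteq>) As" "distinct_adj As" "\<And>A. A \<in> set As \<Longrightarrow> finite A \<and> A \<noteq> {}" "As \<noteq> []"
  shows "length As \<le> card (hd As)"
  using assms
proof (induction As)
  case (Cons A As)
  show ?case
  proof (cases As)
    case Nil
    with Cons.prems show ?thesis by (simp add: Suc_le_eq card_gt_0_iff)
  next
    case (Cons B Bs)
    have "length As \<le> card B" using Cons.IH Cons.prems Cons by auto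
    moreover have "B \<subset> A" using Cons.prems Cons by auto
    then have "card B < card A" using Cons.prems by (intro psubset_card_mono) auto
    ultimately show ?thesis by simp
  qed
qed simp

text \<open>If no simplex collected a full block, every face would have an admissible union of
  labels, and \<open>block_mean\<close> would label the barycentres equivariantly by residues.
  \<open>cyclic_chain_distinct_adj\<close> then yields a flag of \<open>n + 1\<close> faces that is
  too long.\<close>

lemma tucker_cyclic:
  fixes z :: "nat \<Rightarrow> 'a list \<Rightarrow>\<^sub>0 int" and L :: "'a \<Rightarrow> (nat \<times> nat) set"
  assumes p: "prime p"
    and z0: "bdry (z 0) = frag_of []"
    and zSuc: "\<And>q. q < n \<Longrightarrow> bdry (z (Suc q)) = cyc_diff p g q (z q)"
    and keys: "\<And>q xs. q \<le> n \<Longrightarrow> xs \<in> Poly_Mapping.keys (z q) \<Longrightarrow> length xs = Suc q \<and> set xs \<subseteq> S"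
    and gS: "\<And>x. x \<in> S \<Longrightarrow> g x \<in> S"
    and L: "\<And>x. x \<in> S \<Longrightarrow> L x \<noteq> {} \<and> L x \<subseteq> {..<d} \<times> {..<p}"
    and Lg: "\<And>x. x \<in> S \<Longrightarrow> L (g x) = apsnd (shift p) ` L x"
    and n: "d * (p - 1) \<le> n"
  shows "\<exists>q\<le>n. \<exists>xs\<in>Poly_Mapping.keys (z q). \<exists>i<d. {i} \<times> {..<p} \<subseteq> (\<Union>x\<in>set xs. L x)"
proof (rule ccontr)
  assume neg: "\<not> ?thesis"
  have p1: "p > 1" using p prime_gt_1_nat by blast
  define U where "U xs = (\<Union>x\<in>set xs. L x)" for xs
  define a where "a xs = block_mean p (U xs)" for xs
  have U_mono: "U xs \<subseteq> U ys" if "subseq xs ys" for xs ys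
    using subseq_set[OF that] by (auto simp: U_def)
  have adm: "admissible d p (U xs) \<and> set xs \<subseteq> S"
    if "q \<le> n" "ys \<in> Poly_Mapping.keys (z q)" "subseq xs ys" "xs \<noteq> []" for q xs ys
  proof -
    have "set xs \<subseteq> set ys" using that(3) by (rule subseq_set)
    then have S: "set xs \<subseteq> S" using keys that by blast
    have "U xs \<noteq> {}" "U xs \<subseteq> {..<d} \<times> {..<p}"
      using S L \<open>xs \<noteq> []\<close> unfolding U_def by (fastforce simp: neq_Nil_conv)+
    moreover have "\<not> {i} \<times> {..<p} \<subseteq> U xs" if "i < d" for i
    proof -
      have "\<not> {i} \<times> {..<p} \<subseteq> U ys"
        using neg \<open>i < d\<close> \<open>q \<le> n\<close> \<open>ys \<in> _\<close> by (simp add: U_def)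
      then show ?thesis
        using U_mono[OF \<open>subseq xs ys\<close>] by (meson order_trans)
    qed
    ultimately show ?thesis using S by (simp add: admissible_def)
  qed
  have Ug: "U (map g xs) = apsnd (shift p) ` U xs" if "set xs \<subseteq> S" for xs
  proof -
    have "(\<Union>x\<in>set xs. L (g x)) = (\<Union>x\<in>set xs. apsnd (shift p) ` L x)"
      using that Lg by (intro SUP_cong) auto
    then show ?thesis by (simp add: U_def image_UN)
  qed
  have a_pow: "a (map (g ^^ k) xs) = (shift p ^^ k) (a xs) \<and> set (map (g ^^ k) xs) \<subseteq> S
      \<and> admissible d p (U (map (g ^^ k) xs))"
    if "admissible d p (U xs)" "set xs \<subseteq> S" for k xs
  proof (induction k)
    case (Suc k)
    let ?ys = "map (g ^^ k) xs"
    have *: "map (g ^^ Suc k) xs = map g ?ys" by simp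
    have "a (map g ?ys) = shift p (a ?ys)"
      unfolding a_def using Suc Ug[of ?ys] block_mean_shift[OF p, of d "U ?ys"] by simp
    moreover have "admissible d p (U (map g ?ys))"
      using Suc Ug[of ?ys] admissible_shift[of d p "U ?ys"] p1 by simp
    ultimately show ?case
      unfolding * using Suc gS by auto
  qed (use that in simp)
  define y where "y q = subdiv a (z q)" for q
  \<comment> \<open>Subdivision with the label \<open>a\<close> turns the action of \<open>g\<close>
    into that of \<open>shift p\<close>, so the hypotheses on \<open>z\<close> carry over to
    \<open>y\<close>.\<close>
  have sub_pow: "subdiv a (chain_map (g ^^ k) (z q)) = chain_map (shift p ^^ k) (y q)" if "q \<le> n" for k q
    unfolding y_def using adm[OF that] a_pow by (intro subdiv_chain_map) blast
  have "\<exists>xs \<in> Poly_Mapping.keys (y n). distinct_adj xs"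
  proof (rule cyclic_chain_distinct_adj[OF p1])
    show "bdry (y 0) = frag_of []"
      by (simp add: y_def bdry_subdiv z0)
    show "bdry (y (Suc q)) = cyc_diff p (shift p) q (y q)" if "q < n" for q
    proof -
      have "bdry (y (Suc q)) = subdiv a (cyc_diff p g q (z q))"
        using that by (simp add: y_def bdry_subdiv zSuc)
      also have "\<dots> = cyc_diff p (shift p) q (y q)"
        using sub_pow[of q 1] sub_pow[of q] that
        by (simp add: cyc_diff_def subdiv_diff subdiv_sum) (simp add: y_def)
      finally show ?thesis .
    qed
    show "length ys = Suc q \<and> set ys \<subseteq> {..<p}" if q: "q \<le> n" and ys: "ys \<in> Poly_Mapping.keys (y q)" for q ys
    proof -
      obtain xs zs where xs: "xs \<in> Poly_Mapping.keys (z q)" "ys = map a zs" "length zs = length xs"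
        using keys_subdiv[OF ys[unfolded y_def]] by metis
      then show ?thesis
        using keys[OF q xs(1)] p1 by (auto simp: a_def block_mean_def Let_def)
    qed
  qed
  then obtain ys where ys: "ys \<in> Poly_Mapping.keys (y n)" "distinct_adj ys" by blast
  obtain xs zs where xs: "xs \<in> Poly_Mapping.keys (z n)" "ys = map a zs" "length zs = length xs"
    and zs: "\<And>z. z \<in> set zs \<Longrightarrow> z \<noteq> [] \<and> subseq z xs" "sorted_wrt (\<lambda>u v. subseq v u) zs"
    using keys_subdiv[OF ys(1)[unfolded y_def]] by metis
  have len: "length zs = Suc n" using keys[OF _ xs(1)] xs(3) by simp
  \<comment> \<open>Unequal means come from unequal unions, so the \<open>n + 1\<close> nested
    unions decrease strictly, while the largest has at most \<open>d * (p - 1)\<close>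
    elements.\<close>
  have "distinct_adj (map (block_mean p) (map U zs))"
    using ys(2) xs(2) by (simp add: a_def[abs_def] comp_def)
  then have "distinct_adj (map U zs)" by (rule distinct_adj_mapD)
  moreover have "sorted_wrt (\<supseteq>) (map U zs)"
    using zs(2) U_mono by (auto simp: sorted_wrt_map intro: sorted_wrt_mono_rel[rotated])
  moreover have *: "admissible d p A" if "A \<in> set (map U zs)" for A
    using that zs(1) adm[OF _ xs(1)] by auto
  then have "finite A \<and> A \<noteq> {}" if "A \<in> set (map U zs)" for A
    using that admissible_finite[of d p A] by (simp add: admissible_def)
  ultimately have "length (map U zs) \<le> card (hd (map U zs))"
    using len by (intro length_decreasing_sets) auto
  moreover have "card (hd (map U zs)) \<le> d * (p - 1)"
    using len by (intro card_admissible *) (cases zs, auto)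
  ultimately show False using len n by simp
qed

subsection \<open>A Borsuk--Ulam theorem on a join of copies of a cyclic group\<close>

definition mean :: "real list \<Rightarrow> real" where
  "mean xs = sum_list xs / real (length xs)"

lemma mean_diff_const:
  assumes "xs \<noteq> []"
  shows "mean xs - c = mean (map (\<lambda>x. x - c) xs)"
proof -
  have "sum_list (map (\<lambda>x. x - c) xs) = sum_list xs - real (length xs) * c"
    by (induction xs) (auto simp: algebra_simps)
  then show ?thesis using assms by (simp add: mean_def field_simps)
qed

lemma abs_mean_le:
  assumes "\<And>x. x \<in> set xs \<Longrightarrow> \<bar>x\<bar> \<le> b" "xs \<noteq> []"
  shows "\<bar>mean xs\<bar> \<le> b"
proof -
  have "\<bar>sum_list xs\<bar> \<le> sum_list (map abs xs)" by (rule sum_list_abs)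
  also have "\<dots> \<le> real (length xs) * b"
    using sum_list_mono[of xs abs "\<lambda>_. b"] assms(1) by (simp add: sum_list_triv)
  finally show ?thesis using assms(2) by (simp add: mean_def field_simps)
qed

text \<open>The classical contraction factor of barycentric subdivision. An entry of
  \<open>vs\<close> contributes 0 to the average of the differences from itself, which saves one
  summand out of at most \<open>n + 1\<close>; averaging over \<open>us\<close> keeps the
  bound.\<close>

lemma abs_mean_diff_le:
  assumes "us \<noteq> []" "set us \<subseteq> set vs" "length vs \<le> Suc n"
    and diam: "\<And>x y. x \<in> set vs \<Longrightarrow> y \<in> set vs \<Longrightarrow> \<bar>x - y\<bar> \<le> D"
  shows "\<bar>mean us - mean vs\<bar> \<le> real n / real (Suc n) * D"
proof -
  have vs: "vs \<noteq> []" using assms by auto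
  have D: "D \<ge> 0" using diam[of "hd vs" "hd vs"] vs by simp
  have "\<bar>x - mean vs\<bar> \<le> real n / real (Suc n) * D" if x: "x \<in> set vs" for x
  proof -
    obtain ys zs where split: "vs = ys @ x # zs" using x by (metis split_list)
    have "\<bar>mean vs - x\<bar> = \<bar>sum_list (map (\<lambda>y. y - x) (ys @ zs))\<bar> / real (length vs)"
      unfolding mean_diff_const[OF vs] by (simp add: mean_def split)
    also have "\<dots> \<le> real (length vs - 1) * D / real (length vs)"
    proof (rule divide_right_mono)
      have "\<bar>sum_list (map (\<lambda>y. y - x) (ys @ zs))\<bar> \<le> sum_list (map (\<lambda>y. \<bar>y - x\<bar>) (ys @ zs))"
        using sum_list_abs[of "map (\<lambda>y. y - x) (ys @ zs)"] by (simp add: comp_def)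
      also have "\<dots> \<le> sum_list (map (\<lambda>y. D) (ys @ zs))"
        using diam x by (intro sum_list_mono) (auto simp: split)
      finally show "\<bar>sum_list (map (\<lambda>y. y - x) (ys @ zs))\<bar> \<le> real (length vs - 1) * D"
        by (simp add: split sum_list_triv algebra_simps)
    qed simp
    also have "\<dots> = (1 - 1 / real (length vs)) * D"
      using vs by (simp add: field_simps of_nat_diff Suc_leI)
    also have "\<dots> \<le> (1 - 1 / real (Suc n)) * D"
      using assms(3) vs D by (intro mult_right_mono diff_mono divide_left_mono) auto
    also have "1 - 1 / real (Suc n) = real n / real (Suc n)"
      by (simp add: field_simps)
    finally show ?thesis by (simp add: abs_minus_commute)
  qed
  then have "\<bar>mean (map (\<lambda>x. x - mean vs) us)\<bar> \<le> real n / real (Suc n) * D"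
    using assms by (intro abs_mean_le) auto
  then show ?thesis by (simp add: mean_diff_const[OF assms(1)])
qed

text \<open>The point with barycentric coordinates \<open>x s j\<close> at the vertex \<open>j\<close> of the \<open>s\<close>-th factor.\<close>

type_synonym join_point = "nat \<Rightarrow> nat \<Rightarrow> real"

section \<open>The join and the action of the cyclic group on it\<close>

definition barycentre :: "join_point list \<Rightarrow> join_point" where
  "barycentre xs = (\<lambda>s j. mean (map (\<lambda>x. x s j) xs))"

text \<open>The inverse of \<open>shift p\<close>, by \<open>shift_pow_period\<close>.\<close>

definition unshift :: "nat \<Rightarrow> nat \<Rightarrow> nat" where
  "unshift p = shift p ^^ (p - 1)"

text \<open>Coordinates are read at the inverse so that vertex \<open>j\<close> of each factor moves
  to \<open>shift p j\<close>.\<close>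

definition rotate_join :: "nat \<Rightarrow> join_point \<Rightarrow> join_point" where
  "rotate_join p x = (\<lambda>s j. x s (unshift p j))"

text \<open>A facet of the join: the factors are discrete, so a facet selects one vertex
  \<open>\<kappa> s\<close> from each.\<close>

definition join_face :: "nat \<Rightarrow> (nat \<Rightarrow> nat) \<Rightarrow> join_point set" where
  "join_face n \<kappa> = {x. (\<forall>s j. 0 \<le> x s j) \<and> (\<forall>s j. x s j \<noteq> 0 \<longrightarrow> s \<le> n \<and> j = \<kappa> s)
     \<and> (\<Sum>s\<le>n. x s (\<kappa> s)) = 1}"

definition cyclic_join :: "nat \<Rightarrow> nat \<Rightarrow> join_point set" where
  "cyclic_join p n = (\<Union>\<kappa> \<in> {\<kappa>. \<forall>s. \<kappa> s < p}. join_face n \<kappa>)"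

definition join_vertex :: "nat \<Rightarrow> nat \<Rightarrow> join_point" where
  "join_vertex s j = (\<lambda>s' j'. of_bool (s' = s \<and> j' = j))"

lemma unshift_shift:
  assumes "p > 0"
  shows "unshift p (shift p j) = j" "shift p (unshift p j) = j"
proof -
  have "(shift p ^^ Suc (p - 1)) j = j" using assms shift_pow_period by simp
  then show "unshift p (shift p j) = j" "shift p (unshift p j) = j"
    unfolding unshift_def by (simp_all add: funpow_swap1 del: One_nat_def)
qed

lemma unshift_eq_iff: "p > 0 \<Longrightarrow> unshift p j = k \<longleftrightarrow> j = shift p k"
  using unshift_shift by metis

lemma rotate_join_shift: "p > 0 \<Longrightarrow> rotate_join p x s (shift p j) = x s j"
  by (simp add: rotate_join_def unshift_shift)

lemma rotate_join_pow:
  "(rotate_join p ^^ k) x = (\<lambda>s j. x s ((unshift p ^^ k) j))"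
proof (induction k)
  case (Suc k)
  then show ?case by (simp add: rotate_join_def funpow_swap1)
qed simp

lemma rotate_join_period: "rotate_join p ^^ p = id"
proof -
  have "unshift p ^^ p = (shift p ^^ p) ^^ (p - 1)"
    by (simp add: unshift_def funpow_mult mult.commute)
  then show ?thesis
    by (auto simp: fun_eq_iff rotate_join_pow shift_pow_period)
qed

lemma rotate_join_vertex:
  "p > 0 \<Longrightarrow> rotate_join p (join_vertex s j) = join_vertex s (shift p j)"
  by (auto simp: rotate_join_def join_vertex_def unshift_eq_iff intro!: ext)

lemma rotate_join_pow_vertex:
  "p > 0 \<Longrightarrow> (rotate_join p ^^ k) (join_vertex s j) = join_vertex s ((shift p ^^ k) j)"
  by (induction k) (auto simp: rotate_join_vertex)

lemma rotate_join_face: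
  assumes "x \<in> join_face n \<kappa>" "p > 0"
  shows "rotate_join p x \<in> join_face n (shift p \<circ> \<kappa>)"
  unfolding join_face_def
proof (intro CollectI conjI allI impI)
  show "0 \<le> rotate_join p x s j" for s j
    using assms(1) by (simp add: join_face_def rotate_join_def)
next
  fix s j assume "rotate_join p x s j \<noteq> 0"
  then have "s \<le> n" "unshift p j = \<kappa> s"
    using assms(1) by (auto simp: join_face_def rotate_join_def)
  then show "s \<le> n" "j = (shift p \<circ> \<kappa>) s"
    using unshift_shift(2)[OF assms(2), of j] by auto
next
  show "(\<Sum>s\<le>n. rotate_join p x s ((shift p \<circ> \<kappa>) s)) = 1"
    using assms by (simp add: join_face_def rotate_join_shift)
qed

lemma rotate_cyclic_join:
  assumes "x \<in> cyclic_join p n" "p > 0"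
  shows "rotate_join p x \<in> cyclic_join p n"
proof -
  obtain \<kappa> where "\<forall>s. \<kappa> s < p" "x \<in> join_face n \<kappa>"
    using assms by (auto simp: cyclic_join_def)
  then show ?thesis
    unfolding cyclic_join_def using rotate_join_face[of x n \<kappa> p] assms(2)
    by (intro UN_I[of "shift p \<circ> \<kappa>"]) auto
qed

lemma barycentre_rotate: "barycentre (map (rotate_join p) xs) = rotate_join p (barycentre xs)"
  by (simp add: barycentre_def rotate_join_def comp_def)

lemma join_vertex_in_face: "s \<le> n \<Longrightarrow> join_vertex s (\<kappa> s) \<in> join_face n \<kappa>"
proof -
  assume "s \<le> n"
  then have "(\<Sum>s'\<le>n. join_vertex s (\<kappa> s) s' (\<kappa> s')) = (\<Sum>s'\<le>n. if s' = s then 1 else 0)"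
    by (intro sum.cong) (auto simp: join_vertex_def)
  with \<open>s \<le> n\<close> show ?thesis
    by (auto simp: join_face_def join_vertex_def)
qed

lemma join_face_le_1:
  assumes "x \<in> join_face n \<kappa>"
  shows "0 \<le> x s j" "x s j \<le> 1"
proof -
  show "0 \<le> x s j" using assms by (simp add: join_face_def)
  show "x s j \<le> 1"
  proof (cases "x s j = 0")
    case False
    then have "s \<le> n" "j = \<kappa> s" using assms by (auto simp: join_face_def)
    then have "x s j \<le> (\<Sum>s\<le>n. x s (\<kappa> s))"
      using assms member_le_sum[of s "{..n}" "\<lambda>s. x s (\<kappa> s)"] by (simp add: join_face_def)
    then show ?thesis using assms by (simp add: join_face_def)
  qed simp
qed

lemma mean_nonneg: "(\<And>x. x \<in> set xs \<Longrightarrow> 0 \<le> x) \<Longrightarrow> 0 \<le> mean xs"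
  by (auto simp: mean_def intro!: divide_nonneg_nonneg sum_list_nonneg)

lemma barycentre_in_join_face:
  assumes "set xs \<subseteq> join_face n \<kappa>" "xs \<noteq> []"
  shows "barycentre xs \<in> join_face n \<kappa>"
  unfolding join_face_def
proof (intro CollectI conjI allI impI)
  show "0 \<le> barycentre xs s j" for s j
    unfolding barycentre_def using assms by (intro mean_nonneg) (auto simp: join_face_def)
next
  fix s j assume nz: "barycentre xs s j \<noteq> 0"
  have "\<exists>x\<in>set xs. x s j \<noteq> 0"
  proof (rule ccontr)
    assume "\<not> ?thesis"
    then have "map (\<lambda>x. x s j) xs = map (\<lambda>x. 0) xs" by auto
    then have "barycentre xs s j = mean (map (\<lambda>x. 0) xs)" unfolding barycentre_def by metis
    with nz show False by (simp add: mean_def sum_list_triv)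
  qed
  then show "s \<le> n" "j = \<kappa> s"
    using assms by (auto simp: join_face_def)
next
  have "(\<Sum>s\<le>n. sum_list (map (\<lambda>x. x s (\<kappa> s)) xs)) = real (length xs)"
    using assms(1) by (induction xs) (auto simp: join_face_def sum.distrib)
  then show "(\<Sum>s\<le>n. barycentre xs s (\<kappa> s)) = 1"
    using assms(2) by (simp add: barycentre_def mean_def flip: sum_divide_distrib)
qed

section \<open>The fundamental chains of the join and their subdivisions\<close>

primrec join_chain :: "nat \<Rightarrow> nat \<Rightarrow> join_point list \<Rightarrow>\<^sub>0 int" where
  "join_chain p 0 = frag_of [join_vertex 0 0]"
| "join_chain p (Suc q) = cone_chain (join_vertex (Suc q) 0) (cyc_diff p (rotate_join p) q (join_chain p q))"

text \<open>Each chain cones off the differential of the previous one from a vertex of a new factor.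
  That differential is a cycle because \<open>cyc_diff\<close> commutes with the boundary and
  consecutive differentials compose to zero.\<close>

lemma bdry_join_chain_Suc:
  "bdry (join_chain p (Suc q)) = cyc_diff p (rotate_join p) q (join_chain p q)"
proof -
  have "bdry (cyc_diff p (rotate_join p) q (join_chain p q)) = 0"
  proof (induction q)
    case 0
    show ?case by (simp add: cyc_diff_def bdry_diff bdry_chain_map)
  next
    case (Suc q)
    then have "bdry (join_chain p (Suc q)) = cyc_diff p (rotate_join p) q (join_chain p q)"
      by (simp add: bdry_cone)
    then show ?case
      by (simp only: bdry_cyc_diff cyc_diff_cyc_diff[OF rotate_join_period])
  qed
  then show ?thesis by (simp add: bdry_cone)
qed

lemma keys_join_chain:
  assumes "xs \<in> Poly_Mapping.keys (join_chain p q)" "p > 0"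
  shows "length xs = Suc q \<and> (\<exists>\<kappa>. (\<forall>s. \<kappa> s < p) \<and> set xs \<subseteq> (\<lambda>s. join_vertex s (\<kappa> s)) ` {..q})"
  using assms(1)
proof (induction q arbitrary: xs)
  case 0
  then show ?case using assms(2) by (auto simp: keys_frag_of)
next
  case (Suc q)
  then obtain ws where ws: "xs = join_vertex (Suc q) 0 # ws"
    "ws \<in> Poly_Mapping.keys (cyc_diff p (rotate_join p) q (join_chain p q))"
    unfolding join_chain.simps by (meson imageE keys_cone subsetD)
  obtain k ys where ys: "ys \<in> Poly_Mapping.keys (join_chain p q)" "ws = map (rotate_join p ^^ k) ys"
    using keys_cyc_diff[OF ws(2)] by metis
  obtain \<kappa> where \<kappa>: "\<forall>s. \<kappa> s < p" "set ys \<subseteq> (\<lambda>s. join_vertex s (\<kappa> s)) ` {..q}" "length ys = Suc q"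
    using Suc.IH[OF ys(1)] by blast
  \<comment> \<open>Factor \<open>Suc q\<close> does not occur in \<open>ws\<close>, so its vertex
    can be set to 0 while the older choices are rotated.\<close>
  define \<kappa>' where "\<kappa>' s = (if s = Suc q then 0 else (shift p ^^ k) (\<kappa> s))" for s
  have "\<forall>s. \<kappa>' s < p" using \<kappa>(1) assms(2) by (simp add: \<kappa>'_def shift_pow)
  moreover have "set ws \<subseteq> (\<lambda>s. join_vertex s (\<kappa>' s)) ` {..q}"
  proof
    fix w assume "w \<in> set ws"
    then obtain v where v: "v \<in> set ys" "w = (rotate_join p ^^ k) v" using ys(2) by auto
    then obtain s where "s \<le> q" "v = join_vertex s (\<kappa> s)" using \<kappa>(2) by auto
    with v show "w \<in> (\<lambda>s. join_vertex s (\<kappa>' s)) ` {..q}"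
      using assms(2) by (intro image_eqI[of _ _ s]) (auto simp: rotate_join_pow_vertex \<kappa>'_def)
  qed
  moreover have "join_vertex (Suc q) 0 = join_vertex (Suc q) (\<kappa>' (Suc q))" by (simp add: \<kappa>'_def)
  ultimately have "set xs \<subseteq> (\<lambda>s. join_vertex s (\<kappa>' s)) ` {..Suc q}"
    unfolding ws(1) atMost_Suc by auto
  then show ?case
    using \<open>\<forall>s. \<kappa>' s < p\<close> ws(1) ys(2) \<kappa>(3) by auto
qed

definition fine_chain :: "nat \<Rightarrow> nat \<Rightarrow> nat \<Rightarrow> join_point list \<Rightarrow>\<^sub>0 int" where
  "fine_chain p r q = (subdiv barycentre ^^ r) (join_chain p q)"

lemma fine_chain_Suc: "fine_chain p (Suc r) q = subdiv barycentre (fine_chain p r q)"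
  by (simp add: fine_chain_def)

lemma bdry_fine_chain_0: "bdry (fine_chain p r 0) = frag_of []"
  by (induction r) (auto simp: fine_chain_Suc bdry_subdiv, simp add: fine_chain_def)

lemma subdiv_cyc_diff:
  "subdiv barycentre (cyc_diff p (rotate_join p) q c) = cyc_diff p (rotate_join p) q (subdiv barycentre c)"
proof -
  have "barycentre (map (rotate_join p ^^ k) xs) = (rotate_join p ^^ k) (barycentre xs)" for k xs
  proof (induction k)
    case (Suc k)
    have "barycentre (map (rotate_join p ^^ Suc k) xs)
        = barycentre (map (rotate_join p) (map (rotate_join p ^^ k) xs))" by simp
    also have "\<dots> = rotate_join p ((rotate_join p ^^ k) (barycentre xs))"
      by (simp only: barycentre_rotate Suc)
    finally show ?case by (simp add: comp_def)
  qed simp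
  then have *: "subdiv barycentre (chain_map (rotate_join p ^^ k) c)
      = chain_map (rotate_join p ^^ k) (subdiv barycentre c)" for k
    by (intro subdiv_chain_map)
  then show ?thesis using *[of 1] by (simp add: cyc_diff_def subdiv_diff subdiv_sum)
qed

lemma bdry_fine_chain_Suc:
  "bdry (fine_chain p r (Suc q)) = cyc_diff p (rotate_join p) q (fine_chain p r q)"
proof (induction r)
  case 0
  show ?case using bdry_join_chain_Suc by (simp add: fine_chain_def)
next
  case (Suc r)
  then show ?case by (simp add: fine_chain_Suc bdry_subdiv subdiv_cyc_diff)
qed

text \<open>Two entries of a subdivided list are barycentres of nested faces, so
  \<open>abs_mean_diff_le\<close> contracts the coordinate diameter. Taking the factor for
  \<open>n\<close> instead of \<open>q\<close> gives one bound for all degrees.\<close>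

lemma keys_fine_chain:
  assumes "xs \<in> Poly_Mapping.keys (fine_chain p r q)" "p > 0" "q \<le> n"
  shows "length xs = Suc q \<and> (\<exists>\<kappa>. (\<forall>s. \<kappa> s < p) \<and> set xs \<subseteq> join_face n \<kappa>) \<and>
    (\<forall>x\<in>set xs. \<forall>y\<in>set xs. \<forall>s j. \<bar>x s j - y s j\<bar> \<le> (real n / real (Suc n)) ^ r)"
  using assms(1)
proof (induction r arbitrary: xs)
  case 0
  then obtain \<kappa> where \<kappa>: "\<forall>s. \<kappa> s < p" "set xs \<subseteq> (\<lambda>s. join_vertex s (\<kappa> s)) ` {..q}"
    and len: "length xs = Suc q"
    using keys_join_chain[of xs p q] assms by (auto simp: fine_chain_def)
  have sub: "set xs \<subseteq> join_face n \<kappa>"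
    using \<kappa>(2) assms(3) join_vertex_in_face[of _ n \<kappa>] by fastforce
  have "\<bar>x s j - y s j\<bar> \<le> 1" if "x \<in> set xs" "y \<in> set xs" for x y s j
  proof -
    have "x \<in> join_face n \<kappa>" "y \<in> join_face n \<kappa>" using that sub by auto
    from join_face_le_1[OF this(1), of s j] join_face_le_1[OF this(2), of s j]
    show ?thesis by linarith
  qed
  then show ?case using sub \<kappa>(1) len by auto
next
  case (Suc r)
  obtain ys zs where ys: "ys \<in> Poly_Mapping.keys (fine_chain p r q)" "xs = map barycentre zs"
    "length zs = length ys" and zs: "\<And>z. z \<in> set zs \<Longrightarrow> z \<noteq> [] \<and> subseq z ys"
    "sorted_wrt (\<lambda>u v. subseq v u) zs"
    using keys_subdiv[OF Suc.prems[unfolded fine_chain_Suc]] by metis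
  from Suc.IH[OF ys(1)] obtain \<kappa> where len: "length ys = Suc q" and \<kappa>: "\<forall>s. \<kappa> s < p" "set ys \<subseteq> join_face n \<kappa>"
    and D: "\<And>x y s j. x \<in> set ys \<Longrightarrow> y \<in> set ys \<Longrightarrow> \<bar>x s j - y s j\<bar> \<le> (real n / real (Suc n)) ^ r"
    by blast
  have sub: "set xs \<subseteq> join_face n \<kappa>"
  proof
    fix x assume "x \<in> set xs"
    then obtain z where z: "z \<in> set zs" "x = barycentre z" using ys(2) by auto
    with zs(1) have "set z \<subseteq> set ys" "z \<noteq> []" using subseq_set by auto
    with z \<kappa>(2) show "x \<in> join_face n \<kappa>" by (auto intro!: barycentre_in_join_face)
  qed
  have nested: "\<bar>barycentre u s j - barycentre v s j\<bar> \<le> (real n / real (Suc n)) ^ Suc r"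
    if "u \<in> set zs" "v \<in> set zs" "subseq u v" for u v s j
  proof -
    have uv: "u \<noteq> []" "set u \<subseteq> set v" "set v \<subseteq> set ys" "length v \<le> Suc n"
      using that zs(1) subseq_set list_emb_length[of "(=)" v ys] len assms(3) by auto
    have "\<bar>mean (map (\<lambda>x. x s j) u) - mean (map (\<lambda>x. x s j) v)\<bar>
        \<le> real n / real (Suc n) * (real n / real (Suc n)) ^ r"
    proof (rule abs_mean_diff_le)
      fix x y assume "x \<in> set (map (\<lambda>x. x s j) v)" "y \<in> set (map (\<lambda>x. x s j) v)"
      then obtain x' y' where "x' \<in> set ys" "y' \<in> set ys" "x = x' s j" "y = y' s j"
        using uv(3) by auto
      then show "\<bar>x - y\<bar> \<le> (real n / real (Suc n)) ^ r" using D[of x' y' s j] by simp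
    qed (use uv in auto)
    then show ?thesis by (simp add: barycentre_def)
  qed
  have "\<bar>barycentre u s j - barycentre v s j\<bar> \<le> (real n / real (Suc n)) ^ Suc r"
    if uv: "u \<in> set zs" "v \<in> set zs" for u v s j
  proof -
    have "subseq u v \<or> subseq v u"
    proof -
      obtain a b where ab: "a < length zs" "b < length zs" "u = zs ! a" "v = zs ! b"
        using uv by (metis in_set_conv_nth)
      then show ?thesis
        using sorted_wrt_nth_less[OF zs(2)] by (metis linorder_neqE_nat subseq_order.order_refl)
    qed
    then show ?thesis
      using nested[OF uv] nested[OF uv(2,1)] by (auto simp: abs_minus_commute)
  qed
  then show ?case
    using len sub \<kappa>(1) ys(2,3) by auto
qed

text \<open>Otherwise the pairs \<open>(i, j)\<close> with \<open>F i j x \<ge> e\<close> form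
  nonempty equivariant labels. A small simplex whose labels fill block \<open>i\<close> has all
  \<open>F i j\<close> positive at one of its vertices by continuity, against the zero sum.\<close>

theorem borsuk_ulam_cyclic_join:
  fixes F :: "nat \<Rightarrow> nat \<Rightarrow> join_point \<Rightarrow> real"
  assumes p: "prime p"
    and sum0: "\<And>i x. i < d \<Longrightarrow> x \<in> cyclic_join p n \<Longrightarrow> (\<Sum>j<p. F i j x) = 0"
    and equiv: "\<And>i j x. i < d \<Longrightarrow> j < p \<Longrightarrow> x \<in> cyclic_join p n \<Longrightarrow>
        F i (shift p j) (rotate_join p x) = F i j x"
    and cont: "\<And>e. e > 0 \<Longrightarrow> \<exists>\<delta>>0. \<forall>i<d. \<forall>j<p. \<forall>x\<in>cyclic_join p n. \<forall>y\<in>cyclic_join p n.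
        (\<forall>s j. \<bar>x s j - y s j\<bar> \<le> \<delta>) \<longrightarrow> \<bar>F i j x - F i j y\<bar> < e"
    and n: "d * (p - 1) \<le> n" and eps: "\<epsilon> > 0"
  shows "\<exists>x\<in>cyclic_join p n. \<forall>i<d. \<forall>j<p. \<bar>F i j x\<bar> < \<epsilon>"
proof (rule ccontr)
  assume neg: "\<not> ?thesis"
  have p0: "p > 0" using p prime_gt_0_nat by blast
  \<comment> \<open>If all \<open>F i j x\<close> were below \<open>e\<close> and one had absolute
    value at least \<open>\<epsilon>\<close>, that one would be at most \<open>- \<epsilon>\<close>.
    The others add up to at most \<open>\<epsilon> - e\<close>, so the sum would be
    negative.\<close>
  define e where "e = \<epsilon> / real p"
  have e: "e > 0" using eps p0 by (simp add: e_def)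
  define L where "L x = {(i, j). i < d \<and> j < p \<and> F i j x \<ge> e}" for x
  obtain \<delta> where \<delta>: "\<delta> > 0" and close: "\<And>i j x y. i < d \<Longrightarrow> j < p \<Longrightarrow> x \<in> cyclic_join p n \<Longrightarrow>
      y \<in> cyclic_join p n \<Longrightarrow> (\<And>s j. \<bar>x s j - y s j\<bar> \<le> \<delta>) \<Longrightarrow> \<bar>F i j x - F i j y\<bar> < e"
    using cont[OF e] by blast
  have "real n / real (Suc n) < 1" by simp
  then obtain r where r: "(real n / real (Suc n)) ^ r < \<delta>"
    using real_arch_pow_inv[OF \<delta>] by blast
  define z where "z = fine_chain p r"
  have "\<exists>q\<le>n. \<exists>xs\<in>Poly_Mapping.keys (z q). \<exists>i<d. {i} \<times> {..<p} \<subseteq> (\<Union>x\<in>set xs. L x)"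
  proof (rule tucker_cyclic[OF p])
    show "bdry (z 0) = frag_of []" by (simp add: z_def bdry_fine_chain_0)
    show "bdry (z (Suc q)) = cyc_diff p (rotate_join p) q (z q)" for q
      by (simp add: z_def bdry_fine_chain_Suc)
    show "length xs = Suc q \<and> set xs \<subseteq> cyclic_join p n"
      if "q \<le> n" "xs \<in> Poly_Mapping.keys (z q)" for q xs
      using keys_fine_chain[OF that(2)[unfolded z_def] p0 that(1)] by (auto simp: cyclic_join_def)
    show "rotate_join p x \<in> cyclic_join p n" if "x \<in> cyclic_join p n" for x
      using rotate_cyclic_join[OF that p0] .
    show "L x \<noteq> {} \<and> L x \<subseteq> {..<d} \<times> {..<p}" if x: "x \<in> cyclic_join p n" for x
    proof -
      obtain i k where ik: "i < d" "k < p" "\<bar>F i k x\<bar> \<ge> \<epsilon>"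
        using neg x by (meson not_le)
      have "\<exists>j<p. F i j x \<ge> e"
      proof (rule ccontr)
        assume "\<not> ?thesis"
        then have lt: "\<And>j. j < p \<Longrightarrow> F i j x < e" by force
        have "\<epsilon> \<ge> e" using eps p0 by (simp add: e_def field_simps)
        then have "F i k x \<le> - \<epsilon>" using lt[OF ik(2)] ik(3) by linarith
        have "(\<Sum>j<p. F i j x) = F i k x + (\<Sum>j\<in>{..<p} - {k}. F i j x)"
          using ik by (subst sum.remove[of _ k]) auto
        also have "(\<Sum>j\<in>{..<p} - {k}. F i j x) \<le> (\<Sum>j\<in>{..<p} - {k}. e)"
          using lt by (intro sum_mono) (auto intro: less_imp_le)
        also have "\<dots> = \<epsilon> - e"
          using ik p0 by (simp add: e_def field_simps of_nat_diff Suc_leI)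
        finally show False
          using \<open>F i k x \<le> - \<epsilon>\<close> e sum0[OF ik(1) x] by linarith
      qed
      then show ?thesis using ik by (auto simp: L_def)
    qed
    show "L (rotate_join p x) = apsnd (shift p) ` L x" if x: "x \<in> cyclic_join p n" for x
    proof (intro set_eqI iffI)
      fix v assume "v \<in> L (rotate_join p x)"
      then obtain i j where v: "v = (i, j)" "i < d" "j < p" "F i j (rotate_join p x) \<ge> e"
        by (auto simp: L_def)
      obtain j' where j': "j' < p" "j = shift p j'"
        using shift_image[OF p0] v(3) by (metis image_iff lessThan_iff)
      then have "(i, j') \<in> L x" using v equiv[OF v(2) j'(1) x] by (auto simp: L_def)
      then show "v \<in> apsnd (shift p) ` L x" using v(1) j'(2) by force
    next
      fix v assume "v \<in> apsnd (shift p) ` L x"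
      then show "v \<in> L (rotate_join p x)" using equiv x by (auto simp: L_def)
    qed
  qed (rule n)
  then obtain q xs i where q: "q \<le> n" and xs: "xs \<in> Poly_Mapping.keys (z q)"
    and i: "i < d" "{i} \<times> {..<p} \<subseteq> (\<Union>x\<in>set xs. L x)" by blast
  note K = keys_fine_chain[OF xs[unfolded z_def] p0 q]
  have X: "set xs \<subseteq> cyclic_join p n" using K by (auto simp: cyclic_join_def)
  define x where "x = hd xs"
  have "xs \<noteq> []" using K by auto
  then have x: "x \<in> set xs" by (simp add: x_def)
  have "F i j x > 0" if j: "j < p" for j
  proof -
    obtain y where y: "y \<in> set xs" "F i j y \<ge> e"
      using i j by (fastforce simp: L_def)
    have "\<bar>y s t - x s t\<bar> \<le> \<delta>" for s t
      using K x y(1) r by (meson less_imp_le order_trans)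
    then have "\<bar>F i j y - F i j x\<bar> < e" using X x y i(1) j by (intro close) auto
    with y(2) show ?thesis by linarith
  qed
  then have "(\<Sum>j<p. F i j x) > 0"
    using p0 by (intro sum_pos) auto
  with sum0[OF i(1)] X x show False by auto
qed

subsection \<open>Soft partitions\<close>

definition softmax :: "nat \<Rightarrow> (nat \<Rightarrow> real) \<Rightarrow> nat \<Rightarrow> real" where
  "softmax p u k = exp (u k) / (\<Sum>l<p. exp (u l))"

lemma softmax_denom_pos: "p > 0 \<Longrightarrow> (\<Sum>l<p. exp (u l :: real)) > 0" for p :: nat
  by (intro sum_pos) auto

lemma softmax_nonneg: "softmax p u k \<ge> 0"
  by (auto simp: softmax_def intro!: divide_nonneg_nonneg sum_nonneg)

text \<open>The denominator is bounded below by its term number \<open>l\<close>. This gives the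
  decay used in the limit.\<close>

lemma softmax_le_exp:
  assumes "l < p"
  shows "softmax p u k \<le> exp (u k - u l)"
proof -
  have "exp (u l) \<le> (\<Sum>l<p. exp (u l))"
    using assms by (intro member_le_sum) auto
  then have "exp (u k) / (\<Sum>l<p. exp (u l)) \<le> exp (u k) / exp (u l)"
    using assms softmax_denom_pos[of p u] by (intro divide_left_mono) auto
  then show ?thesis by (simp add: softmax_def exp_diff)
qed

lemma softmax_le_1: "k < p \<Longrightarrow> softmax p u k \<le> 1"
  using softmax_le_exp[of k p u k] by simp

lemma sum_softmax: "p > 0 \<Longrightarrow> (\<Sum>k<p. softmax p u k) = 1"
  using softmax_denom_pos[of p u] by (simp add: softmax_def flip: sum_divide_distrib)

text \<open>Numerator and denominator each change by a factor of at most
  \<open>exp \<delta>\<close>.\<close>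

lemma softmax_ratio_le:
  assumes "\<And>l. l < p \<Longrightarrow> \<bar>u l - v l\<bar> \<le> \<delta>" "k < p"
  shows "softmax p u k \<le> exp (2 * \<delta>) * softmax p v k"
proof -
  have p: "p > 0" using assms(2) by simp
  have "exp (u k) \<le> exp \<delta> * exp (v k)"
    using assms(1)[OF assms(2)] by (simp flip: exp_add)
  moreover have "(\<Sum>l<p. exp (v l)) \<le> exp \<delta> * (\<Sum>l<p. exp (u l))"
    unfolding sum_distrib_left using assms(1) by (intro sum_mono) (force simp flip: exp_add)
  ultimately have "exp (u k) * (\<Sum>l<p. exp (v l)) \<le> (exp \<delta> * exp (v k)) * (exp \<delta> * (\<Sum>l<p. exp (u l)))"
    by (intro mult_mono) (auto intro: sum_nonneg)
  also have "\<dots> = exp (2 * \<delta>) * exp (v k) * (\<Sum>l<p. exp (u l))"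
    using exp_add[of \<delta> \<delta>] by (simp add: mult_ac)
  finally show ?thesis
    using softmax_denom_pos[OF p, of u] softmax_denom_pos[OF p, of v]
    by (simp add: softmax_def field_simps)
qed

lemma softmax_close:
  assumes "\<And>l. l < p \<Longrightarrow> \<bar>u l - v l\<bar> \<le> \<delta>" "k < p"
  shows "\<bar>softmax p u k - softmax p v k\<bar> \<le> exp (2 * \<delta>) - 1"
proof -
  have "\<delta> \<ge> 0" using assms(1)[OF assms(2)] by linarith
  have *: "softmax p u k - softmax p v k \<le> exp (2 * \<delta>) - 1"
    if "\<And>l. l < p \<Longrightarrow> \<bar>u l - v l\<bar> \<le> \<delta>" for u v
  proof -
    have "softmax p u k - softmax p v k \<le> (exp (2 * \<delta>) - 1) * softmax p v k"
      using softmax_ratio_le[OF that assms(2)] by (simp add: left_diff_distrib)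
    also have "\<dots> \<le> (exp (2 * \<delta>) - 1) * 1"
      using \<open>\<delta> \<ge> 0\<close> softmax_le_1[OF assms(2)] by (intro mult_left_mono) auto
    finally show ?thesis by simp
  qed
  from *[of u v] *[of v u] assms(1) show ?thesis
    by (simp add: abs_le_iff abs_minus_commute)
qed

lemma softmax_shift:
  assumes "p > 0" "\<And>l. l < p \<Longrightarrow> v (shift p l) = u l" "k < p"
  shows "softmax p v (shift p k) = softmax p u k"
proof -
  have "(\<Sum>l<p. exp (v l)) = (\<Sum>l<p. exp (v (shift p l)))"
    using sum.reindex[OF shift_inj[of p], of "\<lambda>l. exp (v l)"] shift_image[OF assms(1)] by (simp add: comp_def)
  then show ?thesis using assms by (simp add: softmax_def)
qed

section \<open>Tame measures and the integrals of soft pieces\<close>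

definition tame_measure :: "'a::euclidean_space measure \<Rightarrow> bool" where
  "tame_measure \<mu> \<longleftrightarrow> sets \<mu> = sets borel \<and> finite_measure \<mu> \<and> absolutely_continuous lborel \<mu> \<and>
     (\<exists>B. AE y in \<mu>. norm y \<le> B)"

text \<open>The pair \<open>b l\<close> encodes an affine function, whose value at \<open>y\<close>
  is its inner product with \<open>(y, 1)\<close>.\<close>

definition soft_piece :: "nat \<Rightarrow> (nat \<Rightarrow> 'a::euclidean_space \<times> real) \<Rightarrow> nat \<Rightarrow> 'a \<Rightarrow> real" where
  "soft_piece p b k y = softmax p (\<lambda>l. b l \<bullet> (y, 1)) k"

lemma soft_piece_nonneg: "soft_piece p b k y \<ge> 0"
  and soft_piece_le_1: "k < p \<Longrightarrow> soft_piece p b k y \<le> 1"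
  and sum_soft_piece: "p > 0 \<Longrightarrow> (\<Sum>k<p. soft_piece p b k y) = 1"
  by (simp_all add: soft_piece_def softmax_nonneg softmax_le_1 sum_softmax)

lemma borel_measurable_soft_piece:
  assumes "p > 0" "sets \<mu> = sets borel"
  shows "soft_piece p b k \<in> borel_measurable \<mu>"
proof -
  have "continuous_on UNIV (soft_piece p b k)"
    unfolding soft_piece_def softmax_def using softmax_denom_pos[OF assms(1)]
    by (intro continuous_intros) (auto simp: less_imp_neq[symmetric])
  then have "soft_piece p b k \<in> borel_measurable borel"
    by (rule borel_measurable_continuous_onI)
  then show ?thesis using assms(2) measurable_cong_sets by blast
qed

lemma integrable_soft_piece:
  assumes "tame_measure \<mu>" "k < p"
  shows "integrable \<mu> (soft_piece p b k)"
proof -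
  interpret finite_measure \<mu> using assms by (simp add: tame_measure_def)
  show ?thesis
    using assms soft_piece_nonneg[of p b k] soft_piece_le_1[of k p b]
    by (intro integrable_const_bound[where B = 1] borel_measurable_soft_piece) (auto simp: tame_measure_def)
qed

text \<open>The \<open>s\<close>-th factor of the join moves along the basis vector number \<open>s div (p - 1)\<close>. Hence at
  most \<open>p - 1\<close> factors move along a given basis vector, some index \<open>k < p\<close> is missed by them,
  and so the vectors \<open>join_param p n e x k\<close>, \<open>k < p\<close>, never all agree.\<close>

definition join_param :: "nat \<Rightarrow> nat \<Rightarrow> (nat \<Rightarrow> 'b::real_vector) \<Rightarrow> join_point \<Rightarrow> nat \<Rightarrow> 'b" where
  "join_param p n e x k = (\<Sum>s\<le>n. x s k *\<^sub>R e (s div (p - 1)))"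

lemma join_param_rotate:
  "p > 0 \<Longrightarrow> join_param p n e (rotate_join p x) (shift p k) = join_param p n e x k"
  by (simp add: join_param_def rotate_join_shift)

lemma join_param_not_const:
  fixes e :: "nat \<Rightarrow> 'b::euclidean_space"
  assumes p: "p > 1" and x: "x \<in> cyclic_join p n"
    and e: "inj_on e {..n div (p - 1)}" "e ` {..n div (p - 1)} \<subseteq> Basis"
  shows "\<exists>k<p. \<exists>l<p. norm (join_param p n e x k - join_param p n e x l) \<ge> 1 / real (Suc n)"
proof -
  obtain \<kappa> where \<kappa>: "\<And>s. \<kappa> s < p" "x \<in> join_face n \<kappa>"
    using x by (auto simp: cyclic_join_def)
  have nonneg: "\<And>s j. 0 \<le> x s j" and supp: "\<And>s j. x s j \<noteq> 0 \<Longrightarrow> s \<le> n \<and> j = \<kappa> s"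
    and sum1: "(\<Sum>s\<le>n. x s (\<kappa> s)) = 1"
    using \<kappa>(2) by (auto simp: join_face_def)
  obtain s where s: "s \<le> n" "x s (\<kappa> s) \<ge> 1 / real (Suc n)"
  proof (rule ccontr)
    assume "\<not> thesis"
    then have "(\<Sum>s\<le>n. x s (\<kappa> s)) < (\<Sum>s\<le>n. 1 / real (Suc n))"
      using that by (intro sum_strict_mono) (auto simp: not_le[symmetric])
    with sum1 show False by simp
  qed
  define \<beta> where "\<beta> = s div (p - 1)"
  \<comment> \<open>The factors that move along the same basis vector as \<open>s\<close>. There are
    at most \<open>p - 1\<close> of them, so by pigeonhole their vertices miss some index
    \<open>l\<close>, at which this component vanishes.\<close>
  define T where "T = {t. t \<le> n \<and> t div (p - 1) = \<beta>}"
  have T_sub: "T \<subseteq> {\<beta> * (p - 1)..<\<beta> * (p - 1) + (p - 1)}"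
  proof
    fix t assume "t \<in> T"
    then have "t = \<beta> * (p - 1) + t mod (p - 1)" by (metis (mono_tags, lifting) T_def div_mult_mod_eq mem_Collect_eq)
    moreover have "t mod (p - 1) < p - 1" using p by simp
    ultimately show "t \<in> {\<beta> * (p - 1)..<\<beta> * (p - 1) + (p - 1)}" by auto
  qed
  then have finT: "finite T" using finite_subset by blast
  have "card (\<kappa> ` T) \<le> card T" using finT by (rule card_image_le)
  also have "\<dots> \<le> p - 1" using card_mono[OF _ T_sub] by simp
  finally have "card (\<kappa> ` T) < card {..<p}" using p by simp
  then obtain l where l: "l < p" "l \<notin> \<kappa> ` T"
    by (metis (no_types, lifting) card_mono finT finite_imageI lessThan_iff not_le subsetI)
  have \<beta>: "\<beta> \<le> n div (p - 1)" using s(1) by (simp add: \<beta>_def div_le_mono)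
  have comp: "join_param p n e x k \<bullet> e \<beta> = (\<Sum>t\<in>T. x t k)" for k
  proof -
    have "join_param p n e x k \<bullet> e \<beta> = (\<Sum>t\<le>n. x t k * (e (t div (p - 1)) \<bullet> e \<beta>))"
      by (simp add: join_param_def inner_sum_left)
    also have "\<dots> = (\<Sum>t\<le>n. if t \<in> T then x t k else 0)"
    proof (rule sum.cong)
      fix t assume "t \<in> {..n}"
      then have t: "t div (p - 1) \<le> n div (p - 1)" "t \<le> n" by (auto simp: div_le_mono)
      have "e (t div (p - 1)) \<in> Basis" "e \<beta> \<in> Basis" using e(2) t \<beta> by auto
      then have "e (t div (p - 1)) \<bullet> e \<beta> = (if e (t div (p - 1)) = e \<beta> then 1 else 0)"
        by (rule inner_Basis)
      also have "e (t div (p - 1)) = e \<beta> \<longleftrightarrow> t div (p - 1) = \<beta>"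
        using inj_on_eq_iff[OF e(1)] t \<beta> by simp
      finally show "x t k * (e (t div (p - 1)) \<bullet> e \<beta>) = (if t \<in> T then x t k else 0)"
        using t by (simp add: T_def)
    qed simp
    also have "\<dots> = (\<Sum>t\<in>T. x t k)"
      by (simp add: sum.If_cases T_def Collect_conj_eq atMost_def)
    finally show ?thesis .
  qed
  have "(\<Sum>t\<in>T. x t l) = 0"
    using supp l(2) by (intro sum.neutral) blast
  moreover have "x s (\<kappa> s) \<le> (\<Sum>t\<in>T. x t (\<kappa> s))"
    using s(1) nonneg finT by (intro member_le_sum) (auto simp: T_def \<beta>_def)
  ultimately have "1 / real (Suc n) \<le> (join_param p n e x (\<kappa> s) - join_param p n e x l) \<bullet> e \<beta>"
    using s(2) by (simp add: inner_diff_left comp)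
  also have "\<dots> \<le> norm (join_param p n e x (\<kappa> s) - join_param p n e x l)"
  proof -
    have "e \<beta> \<in> Basis" using e(2) \<beta> by auto
    then show ?thesis
      using Basis_le_norm[of "e \<beta>" "join_param p n e x (\<kappa> s) - join_param p n e x l"] by linarith
  qed
  finally show ?thesis using \<kappa>(1) l(1) by blast
qed

text \<open>The functions are far apart at every point of the join by
  \<open>join_param_not_const\<close>; the Borsuk--Ulam theorem supplies a point at which all
  integrals are nearly right.\<close>

lemma approximate_equipartition:
  fixes \<mu> :: "nat \<Rightarrow> 'a::euclidean_space measure"
  assumes p: "prime p"
    and \<mu>: "\<And>i. i < DIM('a) \<Longrightarrow> tame_measure (\<mu> i)"
    and M: "\<And>i. i < DIM('a) \<Longrightarrow> measure (\<mu> i) UNIV = M"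
    and R: "R \<ge> 0" and eps: "\<epsilon> > 0"
  shows "\<exists>b :: nat \<Rightarrow> 'a \<times> real. (\<exists>k<p. \<exists>l<p. norm (b k - b l) \<ge> R) \<and>
    (\<forall>i<DIM('a). \<forall>k<p. \<bar>(LINT y|\<mu> i. soft_piece p b k y) - M / real p\<bar> < \<epsilon>)"
proof -
  have p1: "p > 1" and p0: "p > 0" using p prime_gt_1_nat[of p] by auto
  \<comment> \<open>With this \<open>n\<close> the quotients \<open>s div (p - 1)\<close> run from 0
    to \<open>DIM('a)\<close>, one for each basis vector of \<open>'a \<times> real\<close>. The
    last one is attained by \<open>s = n\<close> only.\<close>
  define n where "n = DIM('a) * (p - 1)"
  \<comment> \<open>Scaling by \<open>Q\<close> turns the lower bound
    \<open>1 / real (Suc n)\<close> of \<open>join_param_not_const\<close> into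
    \<open>R\<close>.\<close>
  define Q where "Q = R * real (Suc n)"
  have Q: "Q \<ge> 0" using R by (simp add: Q_def)
  have "card {..<DIM('a \<times> real)} = card (Basis :: ('a \<times> real) set)" by simp
  then obtain e where "bij_betw e {..<DIM('a \<times> real)} (Basis :: ('a \<times> real) set)"
    using finite_same_card_bij[of "{..<DIM('a \<times> real)}" "Basis :: ('a \<times> real) set"] by auto
  moreover have "{..n div (p - 1)} = {..<DIM('a \<times> real)}" using p1 by (auto simp: n_def)
  ultimately have e: "inj_on e {..n div (p - 1)}" "e ` {..n div (p - 1)} = Basis"
    by (auto simp: bij_betw_def)
  define par where "par x l = Q *\<^sub>R join_param p n e x l" for x l
  define F where "F i k x = (LINT y|\<mu> i. soft_piece p (par x) k y) - M / real p" for i k x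
  have space: "space (\<mu> i) = UNIV" if "i < DIM('a)" for i
    using \<mu>[OF that] by (metis sets_eq_imp_space_eq space_borel tame_measure_def)
  obtain B where B: "B \<ge> 0" "\<And>i. i < DIM('a) \<Longrightarrow> AE y in \<mu> i. norm y \<le> B"
  proof -
    obtain B' where B': "\<And>i. i < DIM('a) \<Longrightarrow> AE y in \<mu> i. norm y \<le> B' i"
      using \<mu> unfolding tame_measure_def by metis
    have "AE y in \<mu> i. norm y \<le> (\<Sum>i<DIM('a). \<bar>B' i\<bar>)" if "i < DIM('a)" for i
    proof -
      have "B' i \<le> (\<Sum>i<DIM('a). \<bar>B' i\<bar>)"
        using member_le_sum[of i "{..<DIM('a)}" "\<lambda>i. \<bar>B' i\<bar>"] that by auto
      then show ?thesis using B'[OF that] by (auto elim!: eventually_mono)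
    qed
    then show ?thesis by (intro that[of "\<Sum>i<DIM('a). \<bar>B' i\<bar>"]) (auto intro: sum_nonneg)
  qed
  have "M \<ge> 0" using M[of 0] by (metis DIM_positive measure_nonneg)
  have "\<exists>x\<in>cyclic_join p n. \<forall>i<DIM('a). \<forall>k<p. \<bar>F i k x\<bar> < \<epsilon>"
  proof (rule borsuk_ulam_cyclic_join[OF p])
    fix i x assume i: "i < DIM('a)"
    have "(\<Sum>k<p. F i k x) = (LINT y|\<mu> i. (\<Sum>k<p. soft_piece p (par x) k y)) - M"
      using integrable_soft_piece[OF \<mu>[OF i]] p0
      by (subst Bochner_Integration.integral_sum) (auto simp: F_def sum_subtractf)
    also have "\<dots> = 0" using M[OF i] space[OF i] p0 by (simp add: sum_soft_piece)
    finally show "(\<Sum>k<p. F i k x) = 0" .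
  next
    fix i k x assume k: "k < p"
    have "soft_piece p (par (rotate_join p x)) (shift p k) = soft_piece p (par x) k"
      unfolding soft_piece_def using p0 k
      by (intro ext softmax_shift) (auto simp: par_def join_param_rotate)
    then show "F i (shift p k) (rotate_join p x) = F i k x" by (simp add: F_def)
  next
    fix \<eta> :: real assume \<eta>: "\<eta> > 0"
    \<comment> \<open>On the ball of radius \<open>B\<close>, a change of the coordinates by at most
      \<open>\<delta>\<close> changes each affine function by at most
      \<open>c * \<delta>\<close>.\<close>
    define c where "c = Q * (real (Suc n) * (B + 1))"
    \<comment> \<open>Chosen so that \<open>softmax_close\<close> yields
      \<open>\<eta> / (M + 1)\<close>; integration over total mass \<open>M\<close> then stays
      strictly below \<open>\<eta>\<close>, even for \<open>M = 0\<close>.\<close>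
    define \<delta> where "\<delta> = ln (1 + \<eta> / (M + 1)) / (2 * (c + 1))"
    have c: "c \<ge> 0" using Q B(1) by (simp add: c_def)
    have "\<eta> / (M + 1) > 0" using \<eta> \<open>M \<ge> 0\<close> by simp
    then have \<delta>: "\<delta> > 0" using c by (simp add: \<delta>_def)
    have "2 * (c * \<delta>) \<le> 2 * ((c + 1) * \<delta>)" using \<delta> by simp
    also have "\<dots> = ln (1 + \<eta> / (M + 1))" using c by (simp add: \<delta>_def divide_simps)
    finally have "exp (2 * (c * \<delta>)) \<le> 1 + \<eta> / (M + 1)"
      using \<open>\<eta> / (M + 1) > 0\<close> by (metis add_pos_pos exp_le_cancel_iff exp_ln zero_less_one)
    then have exp_le: "exp (2 * (c * \<delta>)) - 1 \<le> \<eta> / (M + 1)" by simp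
    have "\<bar>F i k x - F i k x'\<bar> < \<eta>"
      if i: "i < DIM('a)" and k: "k < p" and close: "\<forall>s j. \<bar>x s j - x' s j\<bar> \<le> \<delta>" for i k x x'
    proof -
      interpret finite_measure "\<mu> i" using \<mu>[OF i] by (simp add: tame_measure_def)
      have AE: "AE y in \<mu> i. \<bar>soft_piece p (par x) k y - soft_piece p (par x') k y\<bar> \<le> \<eta> / (M + 1)"
        using B(2)[OF i]
      proof eventually_elim
        case (elim y)
        have "\<bar>par x l \<bullet> (y, 1) - par x' l \<bullet> (y, 1)\<bar> \<le> c * \<delta>" for l
        proof -
          have "norm (y, 1::real) \<le> norm y + 1"
            using norm_Pair_le[of y "1::real"] by simp
          then have "norm (y, 1::real) \<le> B + 1" using elim by linarith
          have "\<bar>(join_param p n e x l - join_param p n e x' l) \<bullet> (y, 1)\<bar>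
            = \<bar>\<Sum>s\<le>n. (x s l - x' s l) * (e (s div (p - 1)) \<bullet> (y, 1))\<bar>"
            by (simp add: join_param_def inner_sum_left inner_diff_left sum_subtractf left_diff_distrib)
          also have "\<dots> \<le> (\<Sum>s\<le>n. \<bar>(x s l - x' s l) * (e (s div (p - 1)) \<bullet> (y, 1))\<bar>)"
            by (rule sum_abs)
          also have "\<dots> \<le> (\<Sum>s\<le>n. \<delta> * (B + 1))"
          proof (rule sum_mono)
            fix s assume "s \<in> {..n}"
            then have "e (s div (p - 1)) \<in> Basis" using e(2) by (auto simp: div_le_mono)
            then have "\<bar>e (s div (p - 1)) \<bullet> (y, 1)\<bar> \<le> B + 1"
              using Basis_le_norm[of "e (s div (p - 1))" "(y, 1)"] \<open>norm (y, 1::real) \<le> B + 1\<close>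
              by (simp add: inner_commute)
            then show "\<bar>(x s l - x' s l) * (e (s div (p - 1)) \<bullet> (y, 1))\<bar> \<le> \<delta> * (B + 1)"
              unfolding abs_mult using close \<delta> by (intro mult_mono) auto
          qed
          finally have "\<bar>(join_param p n e x l - join_param p n e x' l) \<bullet> (y, 1)\<bar>
            \<le> real (Suc n) * (B + 1) * \<delta>" by (simp add: mult_ac)
          then have "Q * \<bar>(join_param p n e x l - join_param p n e x' l) \<bullet> (y, 1)\<bar> \<le> c * \<delta>"
            unfolding c_def using Q by (simp add: mult_left_mono mult.assoc)
          moreover have "\<bar>par x l \<bullet> (y, 1) - par x' l \<bullet> (y, 1)\<bar>
            = Q * \<bar>(join_param p n e x l - join_param p n e x' l) \<bullet> (y, 1)\<bar>"
            using Q by (simp add: par_def abs_mult inner_diff_left flip: right_diff_distrib)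
          ultimately show ?thesis by simp
        qed
        then have "\<bar>soft_piece p (par x) k y - soft_piece p (par x') k y\<bar> \<le> exp (2 * (c * \<delta>)) - 1"
          unfolding soft_piece_def using k by (intro softmax_close)
        with exp_le show ?case by linarith
      qed
      have int: "integrable (\<mu> i) (soft_piece p (par z) k)" for z
        using integrable_soft_piece[OF \<mu>[OF i] k] .
      have "\<bar>F i k x - F i k x'\<bar> = \<bar>LINT y|\<mu> i. soft_piece p (par x) k y - soft_piece p (par x') k y\<bar>"
        using int by (simp add: F_def)
      also have "\<dots> \<le> (LINT y|\<mu> i. \<bar>soft_piece p (par x) k y - soft_piece p (par x') k y\<bar>)"
        by (rule integral_abs_bound)
      also have "\<dots> \<le> (LINT y|\<mu> i. \<eta> / (M + 1))"
        using int AE by (intro integral_mono_AE) auto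
      also have "\<dots> = M * (\<eta> / (M + 1))" using M[OF i] space[OF i] by simp
      also have "\<dots> < \<eta>" using \<open>M \<ge> 0\<close> \<eta> by (simp add: field_simps)
      finally show ?thesis .
    qed
    then show "\<exists>\<delta>>0. \<forall>i<DIM('a). \<forall>k<p. \<forall>x\<in>cyclic_join p n. \<forall>y\<in>cyclic_join p n.
        (\<forall>s j. \<bar>x s j - y s j\<bar> \<le> \<delta>) \<longrightarrow> \<bar>F i k x - F i k y\<bar> < \<eta>"
      using \<delta> by blast
  qed (simp_all add: n_def eps)
  then obtain x where x: "x \<in> cyclic_join p n" "\<And>i k. i < DIM('a) \<Longrightarrow> k < p \<Longrightarrow> \<bar>F i k x\<bar> < \<epsilon>" by blast
  obtain k l where kl: "k < p" "l < p"
    "norm (join_param p n e x k - join_param p n e x l) \<ge> 1 / real (Suc n)"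
    using join_param_not_const[OF p1 x(1) e(1)] e(2) by auto
  have "R = Q * (1 / real (Suc n))" by (simp add: Q_def)
  also have "\<dots> \<le> Q * norm (join_param p n e x k - join_param p n e x l)"
    using kl(3) Q by (intro mult_left_mono)
  also have "\<dots> = norm (par x k - par x l)"
    using Q by (simp add: par_def flip: scaleR_right_diff_distrib)
  finally have "R \<le> norm (par x k - par x l)" .
  then show ?thesis
    using kl x(2) by (intro exI[of _ "par x"]) (auto simp: F_def)
qed

subsection \<open>Passing to the limit\<close>

lemma convergent_subseq_family:
  fixes f :: "'i \<Rightarrow> nat \<Rightarrow> 'b::metric_space"
  assumes "finite I" "compact S" "\<And>i N. i \<in> I \<Longrightarrow> f i N \<in> S"
  shows "\<exists>r. strict_mono r \<and> (\<forall>i\<in>I. \<exists>l. (f i \<circ> r) \<longlonglongrightarrow> l)"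
  using assms(1,3)
proof (induction I rule: finite_induct)
  case empty
  show ?case by (intro exI[of _ id]) (simp add: strict_mono_def)
next
  case (insert i I)
  then obtain r where r: "strict_mono r" "\<forall>j\<in>I. \<exists>l. (f j \<circ> r) \<longlonglongrightarrow> l" by blast
  have "\<forall>N. (f i \<circ> r) N \<in> S" using insert.prems by simp
  then obtain l r' where r': "strict_mono (r' :: nat \<Rightarrow> nat)" "((f i \<circ> r) \<circ> r') \<longlonglongrightarrow> l"
    using assms(2) unfolding compact_def by blast
  have "\<exists>l. (f j \<circ> (r \<circ> r')) \<longlonglongrightarrow> l" if "j \<in> insert i I" for j
    using that r(2) r' LIMSEQ_subseq_LIMSEQ[OF _ r'(1)] by (fastforce simp: comp_assoc)
  then show ?case
    using strict_mono_o[OF r(1) r'(1)] by blast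
qed

text \<open>Radial compactification: the limit of \<open>squash \<circ> v\<close> lies in the open unit ball if \<open>v\<close> stays
  bounded, and is the direction of escape on the unit sphere otherwise.\<close>

definition squash :: "'b::real_normed_vector \<Rightarrow> 'b" where
  "squash v = v /\<^sub>R (1 + norm v)"

lemma one_plus_norm_pos [simp]: "1 + norm v > 0"
  using norm_ge_zero[of v] by linarith

lemma one_plus_norm_nonzero [simp]: "1 + norm v \<noteq> 0"
  using one_plus_norm_pos[of v] by (metis less_irrefl)

lemma norm_squash: "norm (squash v) = norm v / (1 + norm v)"
  by (simp add: squash_def divide_inverse abs_of_pos mult.commute)

lemma norm_squash_le: "norm (squash v) \<le> 1"
  by (simp add: norm_squash)

lemma squash_minus: "squash (- v) = - squash v"
  by (simp add: squash_def)

lemma norm_squash_limit_le: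
  assumes "(\<lambda>N. squash (v N)) \<longlonglongrightarrow> c"
  shows "norm c \<le> 1"
  using tendsto_norm[OF assms] norm_squash_le by (intro LIMSEQ_le_const2) auto

lemma squash_limit_bounded:
  assumes "(\<lambda>N. squash (v N)) \<longlonglongrightarrow> c" "norm c < 1"
  shows "\<exists>B. \<forall>\<^sub>F N in sequentially. norm (v N) \<le> B"
proof -
  obtain t where t: "norm c < t" "t < 1" using assms(2) dense by blast
  have "\<forall>\<^sub>F N in sequentially. norm (squash (v N)) < t"
    using order_tendstoD(2)[OF tendsto_norm[OF assms(1)] t(1)] .
  then have "\<forall>\<^sub>F N in sequentially. norm (v N) \<le> t / (1 - t)"
  proof eventually_elim
    case (elim N)
    then have "norm (v N) < t * (1 + norm (v N))"
      by (simp add: norm_squash divide_less_eq)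
    with t show ?case by (simp add: field_simps)
  qed
  then show ?thesis by blast
qed

text \<open>\<open>1 + norm v\<close> is the inverse of \<open>1 - norm (squash v)\<close>, which is
  positive and tends to 0.\<close>

lemma squash_limit_unbounded:
  fixes v :: "nat \<Rightarrow> 'b::real_normed_vector"
  assumes "(\<lambda>N. squash (v N)) \<longlonglongrightarrow> c" "norm c = 1"
  shows "filterlim (\<lambda>N. 1 + norm (v N)) at_top sequentially"
proof -
  have eq: "1 + norm (v N) = inverse (1 - norm (squash (v N)))" for N
    by (simp add: norm_squash field_simps)
  have "(\<lambda>N. 1 - norm (squash (v N))) \<longlonglongrightarrow> 0"
    using tendsto_diff[OF tendsto_const tendsto_norm[OF assms(1)], of 1] assms(2) by simp
  moreover have "1 - norm (squash (v N)) > 0" for N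
    using one_plus_norm_pos[of "v N"] by (simp add: norm_squash divide_less_eq)
  ultimately show ?thesis
    unfolding eq by (intro filterlim_inverse_at_top) auto
qed

text \<open>The inner product is \<open>squash (v N) \<bullet> w\<close>, with positive limit, times
  the factor \<open>1 + norm (v N)\<close>, which tends to infinity.\<close>

lemma squash_limit_inner:
  fixes v :: "nat \<Rightarrow> 'b::real_inner"
  assumes "(\<lambda>N. squash (v N)) \<longlonglongrightarrow> c" "norm c = 1" "c \<bullet> w > 0"
  shows "filterlim (\<lambda>N. v N \<bullet> w) at_top sequentially"
proof -
  have "v N \<bullet> w = (squash (v N) \<bullet> w) * (1 + norm (v N))" for N
    by (simp add: squash_def field_simps)
  moreover have "(\<lambda>N. squash (v N) \<bullet> w) \<longlonglongrightarrow> c \<bullet> w"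
    using assms(1) by (intro tendsto_intros)
  ultimately show ?thesis
    using filterlim_tendsto_pos_mult_at_top[OF _ assms(3) squash_limit_unbounded[OF assms(1,2)]] by simp
qed

text \<open>Either this is a hyperplane, or \<open>fst c = 0\<close>; then \<open>snd c\<close> is
  nonzero and the set is empty.\<close>

lemma affine_zero_set_null:
  fixes c :: "'a::euclidean_space \<times> real"
  assumes "c \<noteq> 0"
  shows "{y. c \<bullet> (y, 1) = 0} \<in> null_sets lborel"
proof -
  have "{y. c \<bullet> (y, 1) = 0} = {y. fst c \<bullet> y = - snd c}"
    by (cases c) (auto simp: inner_prod_def)
  moreover have "negligible {y. fst c \<bullet> y = - snd c}"
    using assms by (intro negligible_hyperplane) (auto simp: prod_eq_iff)
  moreover have "closed {y. fst c \<bullet> y = - snd c}" by (rule closed_hyperplane)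
  ultimately show ?thesis
    by (simp add: negligible_iff_null_sets null_sets_completion_iff borel_closed)
qed

lemma open_subset_null_empty:
  fixes U :: "'a::euclidean_space set"
  assumes "open U" "U \<subseteq> N" "N \<in> null_sets lborel"
  shows "U = {}"
proof -
  have "negligible N" using assms(3) by (simp add: negligible_iff_null_sets null_sets_completionI)
  then show ?thesis using assms(1,2) negligible_subset open_not_negligible by blast
qed

text \<open>Approximate equipartitions with spread at least \<open>N\<close> and error below
  \<open>1 / real (Suc N)\<close> are refined to a subsequence along which all squashed differences
  converge. The weight \<open>w j\<close> counts the indices merged into class
  \<open>j\<close>.\<close>

lemma coarse_equipartition:
  fixes \<mu> :: "nat \<Rightarrow> 'a::euclidean_space measure"
  assumes p: "prime p"
    and \<mu>: "\<And>i. i < DIM('a) \<Longrightarrow> tame_measure (\<mu> i)"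
    and M: "\<And>i. i < DIM('a) \<Longrightarrow> measure (\<mu> i) UNIV = M"
  shows "\<exists>(J :: nat set) w D. finite J \<and> (\<forall>j\<in>J. closed (D j) \<and> convex (D j) \<and> 1 \<le> w j \<and> w j < p) \<and>
    (\<Sum>j\<in>J. w j) = p \<and> disjoint_family_on (\<lambda>j. interior (D j)) J \<and> (\<Union>j\<in>J. D j) = UNIV \<and>
    (\<forall>i<DIM('a). \<forall>j\<in>J. measure (\<mu> i) (D j) = real (w j) * (M / real p))"
proof -
  have p1: "p > 1" and p0: "p > 0" using p prime_gt_1_nat[of p] by auto
  have "\<forall>N::nat. \<exists>b :: nat \<Rightarrow> 'a \<times> real. (\<exists>k<p. \<exists>l<p. norm (b k - b l) \<ge> real N) \<and>
    (\<forall>i<DIM('a). \<forall>k<p. \<bar>(LINT y|\<mu> i. soft_piece p b k y) - M / real p\<bar> < 1 / real (Suc N))"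
    using approximate_equipartition[of p \<mu> M, OF p \<mu> M] by auto
  then obtain b0 :: "nat \<Rightarrow> nat \<Rightarrow> 'a \<times> real"
    where b0_far: "\<And>N. \<exists>k<p. \<exists>l<p. norm (b0 N k - b0 N l) \<ge> real N"
    and b0_int: "\<And>N i k. i < DIM('a) \<Longrightarrow> k < p \<Longrightarrow>
      \<bar>(LINT y|\<mu> i. soft_piece p (b0 N) k y) - M / real p\<bar> < 1 / real (Suc N)"
    by metis
  obtain r where r: "strict_mono r"
    and conv: "\<forall>kl\<in>{..<p} \<times> {..<p}. \<exists>l. ((\<lambda>N. squash (b0 N (fst kl) - b0 N (snd kl))) \<circ> r) \<longlonglongrightarrow> l"
    using convergent_subseq_family[of "{..<p} \<times> {..<p}" "cball 0 1"
        "\<lambda>kl N. squash (b0 N (fst kl) - b0 N (snd kl))"] by (auto simp: norm_squash_le)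
  define b where "b N = b0 (r N)" for N
  \<comment> \<open>The subsequence satisfies \<open>N \<le> r N\<close>, so the spread is still at
    least \<open>N\<close>.\<close>
  have b_far: "\<exists>k<p. \<exists>l<p. norm (b N k - b N l) \<ge> real N" for N
    using b0_far[of "r N"] seq_suble[OF r, of N] unfolding b_def by (meson of_nat_le_iff order_trans)
  have b_int: "(\<lambda>N. LINT y|\<mu> i. soft_piece p (b N) k y) \<longlonglongrightarrow> M / real p" if "i < DIM('a)" "k < p" for i k
  proof -
    have "(\<lambda>N. (LINT y|\<mu> i. soft_piece p (b0 N) k y) - M / real p) \<longlonglongrightarrow> 0"
    proof (rule Lim_null_comparison[OF _ LIMSEQ_Suc[OF lim_1_over_n]])
      show "\<forall>\<^sub>F N in sequentially. norm ((LINT y|\<mu> i. soft_piece p (b0 N) k y) - M / real p)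
          \<le> 1 / real (Suc N)"
        using b0_int[OF that] by (intro always_eventually allI) (simp only: real_norm_def less_imp_le)
    qed
    then have "(\<lambda>N. LINT y|\<mu> i. soft_piece p (b0 N) k y) \<longlonglongrightarrow> M / real p"
      by (simp add: LIM_zero_iff)
    from LIMSEQ_subseq_LIMSEQ[OF this r] show ?thesis by (simp add: b_def comp_def)
  qed
  obtain c where c: "\<And>k l. k < p \<Longrightarrow> l < p \<Longrightarrow> (\<lambda>N. squash (b N k - b N l)) \<longlonglongrightarrow> c k l"
  proof -
    have "\<exists>l'. (\<lambda>N. squash (b N k - b N l)) \<longlonglongrightarrow> l'" if "k < p" "l < p" for k l
      using conv[rule_format, of "(k, l)"] that by (simp add: b_def comp_def)
    then show ?thesis using that by metis
  qed
  have c_le: "norm (c k l) \<le> 1" if "k < p" "l < p" for k l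
    using norm_squash_limit_le[OF c[OF that]] .
  have c_swap: "c l k = - c k l" if "k < p" "l < p" for k l
  proof -
    have "(\<lambda>N. squash (b N l - b N k)) \<longlonglongrightarrow> - c k l"
      using tendsto_minus[OF c[OF that]] by (simp flip: squash_minus)
    then show ?thesis using c[OF that(2,1)] LIMSEQ_unique by blast
  qed
  \<comment> \<open>The limit lies inside the open unit ball exactly if the difference stays bounded
    (\<open>near_iff\<close>), which makes this an equivalence relation on indices below
    \<open>p\<close>.\<close>
  define near where "near k l \<longleftrightarrow> norm (c k l) < 1" for k l
  have near_iff: "near k l \<longleftrightarrow> (\<exists>B. \<forall>\<^sub>F N in sequentially. norm (b N k - b N l) \<le> B)"
    if kl: "k < p" "l < p" for k l
  proof
    assume "near k l"
    then show "\<exists>B. \<forall>\<^sub>F N in sequentially. norm (b N k - b N l) \<le> B"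
      using squash_limit_bounded[OF c[OF kl]] by (simp add: near_def)
  next
    assume "\<exists>B. \<forall>\<^sub>F N in sequentially. norm (b N k - b N l) \<le> B"
    then obtain B where B: "\<forall>\<^sub>F N in sequentially. norm (b N k - b N l) \<le> B" by blast
    show "near k l"
    proof (rule ccontr)
      assume "\<not> near k l"
      then have "norm (c k l) = 1" using c_le[OF kl] by (simp add: near_def)
      from squash_limit_unbounded[OF c[OF kl] this]
      have "\<forall>\<^sub>F N in sequentially. 1 + norm (b N k - b N l) > B + 1"
        unfolding filterlim_at_top_dense by blast
      with B have "\<forall>\<^sub>F N in sequentially. False" by eventually_elim simp
      then show False by simp
    qed
  qed
  have near_refl: "near k k" if "k < p" for k
    using near_iff[OF that that] by (auto intro!: exI[of _ 0])
  have near_sym: "near l k" if "near k l" "k < p" "l < p" for k l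
    using that c_swap[of k l] by (simp add: near_def)
  have near_trans: "near k m" if kl: "near k l" and lm: "near l m" and p: "k < p" "l < p" "m < p" for k l m
  proof -
    obtain B1 B2 where "\<forall>\<^sub>F N in sequentially. norm (b N k - b N l) \<le> B1"
      "\<forall>\<^sub>F N in sequentially. norm (b N l - b N m) \<le> B2"
      using near_iff kl lm p by blast
    then have "\<forall>\<^sub>F N in sequentially. norm (b N k - b N m) \<le> B1 + B2"
    proof eventually_elim
      case (elim N)
      then show ?case
        using norm_triangle_ineq[of "b N k - b N l" "b N l - b N m"] by simp
    qed
    then show ?thesis using near_iff p by blast
  qed
  have not_near: "norm (c k l) = 1" if "\<not> near k l" "k < p" "l < p" for k l
    using that c_le[of k l] by (simp add: near_def)
  define cls where "cls j = {k. k < p \<and> near j k}" for j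
  \<comment> \<open>Each class is represented by its least index.\<close>
  define J where "J = {j. j < p \<and> (\<forall>k<j. \<not> near k j)}"
  define w where "w j = card (cls j)" for j
  \<comment> \<open>For \<open>l\<close> outside the class of \<open>j\<close>, \<open>c j l\<close>
    is the direction in which \<open>b N j - b N l\<close> escapes. Its sign at \<open>y\<close>
    tells which of the two functions wins there; ties lie in \<open>Z\<close>.\<close>
  define D where "D j = {y. \<forall>l<p. \<not> near j l \<longrightarrow> c j l \<bullet> (y, 1) \<ge> 0}" for j
  define Z where "Z = (\<Union>kl \<in> {kl. fst kl < p \<and> snd kl < p \<and> \<not> near (fst kl) (snd kl)}.
    {y :: 'a. c (fst kl) (snd kl) \<bullet> (y, 1) = 0})"
  have J: "finite J" "J \<subseteq> {..<p}" by (auto simp: J_def)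
  have fin_cls: "finite (cls j)" for j by (simp add: cls_def)
  have Z_null: "Z \<in> null_sets lborel"
  proof -
    have "finite {kl. fst kl < p \<and> snd kl < p \<and> \<not> near (fst kl) (snd kl)}"
      by (rule finite_subset[of _ "{..<p} \<times> {..<p}"]) auto
    moreover have "c k l \<noteq> 0" if "k < p" "l < p" "\<not> near k l" for k l
      using not_near[of k l] that by auto
    ultimately show ?thesis
      unfolding Z_def by (intro null_sets.finite_UN affine_zero_set_null) auto
  qed
  have cls_Un: "(\<Union>j\<in>J. cls j) = {..<p}"
  proof (intro equalityI subsetI)
    fix k assume "k \<in> {..<p}"
    then have k: "k < p" by simp
    define j where "j = (LEAST j. j < p \<and> near j k)"
    have j: "j < p \<and> near j k" unfolding j_def by (rule LeastI[of _ k]) (simp add: k near_refl)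
    have "\<not> near l j" if "l < j" for l
    proof
      assume "near l j"
      then have "l < p \<and> near l k" using near_trans[of l j k] j k that by auto
      then show False using not_less_Least[of l "\<lambda>j. j < p \<and> near j k"] that by (simp add: j_def)
    qed
    then show "k \<in> (\<Union>j\<in>J. cls j)" using j k by (auto simp: J_def cls_def)
  qed (auto simp: cls_def)
  have J_far: "\<not> near j j'" if "j \<in> J" "j' \<in> J" "j \<noteq> j'" for j j'
    using that near_sym[of j j'] by (cases "j < j'") (auto simp: J_def)
  have cls_disj: "cls j \<inter> cls j' = {}" if "j \<in> J" "j' \<in> J" "j \<noteq> j'" for j j'
  proof (rule ccontr)
    assume "cls j \<inter> cls j' \<noteq> {}"
    then obtain k where "k < p" "near j k" "near j' k" by (auto simp: cls_def)
    then have "near j j'" using near_trans[of j k j'] near_sym[of j' k] that J by auto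
    then show False using J_far that by blast
  qed
  have sum_cls: "(\<Sum>j\<in>J. \<Sum>k\<in>cls j. f k) = (\<Sum>k<p. f k)" for f :: "nat \<Rightarrow> 'x::comm_monoid_add"
    unfolding cls_Un[symmetric] using J(1) fin_cls cls_disj by (intro sum.UNION_disjoint[symmetric]) auto
  have sum_w: "(\<Sum>j\<in>J. w j) = p"
    using sum_cls[of "\<lambda>_. 1::nat"] by (simp add: w_def)
  have w_pos: "1 \<le> w j" if "j \<in> J" for j
  proof -
    have "j \<in> cls j" using that J near_refl by (auto simp: cls_def)
    then show ?thesis using fin_cls[of j] by (auto simp: w_def Suc_le_eq card_gt_0_iff)
  qed
  \<comment> \<open>A single class would bound all mutual differences by one constant, against
    \<open>b_far\<close>. So there are at least two classes, which lets the induction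
    descend.\<close>
  have w_less: "w j < p" if "j \<in> J" for j
  proof (rule ccontr)
    assume "\<not> w j < p"
    moreover have "cls j \<subseteq> {..<p}" by (auto simp: cls_def)
    ultimately have cls: "cls j = {..<p}"
      by (intro card_seteq) (auto simp: w_def)
    have "j < p" using that J by auto
    then have "near k l" if "k < p" "l < p" for k l
      using that cls near_sym[of j k] near_trans[of k j l] by (auto simp: cls_def)
    then have "\<forall>kl\<in>{..<p} \<times> {..<p}. \<exists>B. \<forall>\<^sub>F N in sequentially. norm (b N (fst kl) - b N (snd kl)) \<le> B"
      using near_iff by auto
    from bchoice[OF this] obtain B
      where "\<forall>kl\<in>{..<p} \<times> {..<p}. \<forall>\<^sub>F N in sequentially. norm (b N (fst kl) - b N (snd kl)) \<le> B kl" ..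
    then have "\<forall>\<^sub>F N in sequentially. \<forall>kl\<in>{..<p} \<times> {..<p}. norm (b N (fst kl) - b N (snd kl)) \<le> B kl"
      by (intro eventually_ball_finite) auto
    moreover have "\<forall>\<^sub>F N in sequentially. real N > (\<Sum>kl\<in>{..<p} \<times> {..<p}. \<bar>B kl\<bar>)"
      using filterlim_real_sequentially by (simp add: filterlim_at_top_dense)
    ultimately have "\<forall>\<^sub>F N in sequentially. False"
    proof eventually_elim
      case (elim N)
      obtain k l where kl: "k < p" "l < p" "norm (b N k - b N l) \<ge> real N" using b_far by blast
      have "norm (b N k - b N l) \<le> B (k, l)" using elim(1) kl by auto
      also have "\<dots> \<le> (\<Sum>kl\<in>{..<p} \<times> {..<p}. \<bar>B kl\<bar>)"
        using member_le_sum[of "(k, l)" "{..<p} \<times> {..<p}" "\<lambda>kl. \<bar>B kl\<bar>"] kl by auto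
      finally show False using kl elim(2) by linarith
    qed
    then show False by simp
  qed
  \<comment> \<open>If \<open>y\<close> lies in \<open>D j\<close>, function \<open>j\<close> beats
    all indices outside its class, whose soft pieces die out and leave total 1. If not, some
    \<open>l\<close> beats \<open>j\<close> and with it the whole class.\<close>
  have limit: "(\<lambda>N. \<Sum>k\<in>cls j. soft_piece p (b N) k y) \<longlonglongrightarrow> indicator (D j) y"
    if j: "j \<in> J" and y: "y \<notin> Z" for j y
  proof -
    have jp: "j < p" using j J by auto
    have small: "(\<lambda>N. soft_piece p (b N) k y) \<longlonglongrightarrow> 0"
      if "filterlim (\<lambda>N. (b N l - b N k) \<bullet> (y, 1)) at_top sequentially" "l < p" for k l
    proof (rule Lim_null_comparison)
      show "\<forall>\<^sub>F N in sequentially. norm (soft_piece p (b N) k y) \<le> exp (- ((b N l - b N k) \<bullet> (y, 1)))"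
        using softmax_le_exp[OF that(2), of "\<lambda>l. b N l \<bullet> (y, 1)" k for N]
        by (auto simp: soft_piece_def softmax_nonneg inner_diff_left)
      show "(\<lambda>N. exp (- ((b N l - b N k) \<bullet> (y, 1)))) \<longlonglongrightarrow> 0"
        using that(1) by (intro filterlim_compose[OF exp_at_bot]) (simp add: filterlim_uminus_at_bot)
    qed
    show ?thesis
    proof (cases "y \<in> D j")
      case True
      have "(\<lambda>N. soft_piece p (b N) l y) \<longlonglongrightarrow> 0" if "l \<in> {..<p} - cls j" for l
      proof (rule small[OF _ jp])
        have l: "l < p" "\<not> near j l" using that by (auto simp: cls_def)
        have "c j l \<bullet> (y, 1) \<noteq> 0" using y l jp by (force simp: Z_def)
        then have "c j l \<bullet> (y, 1) > 0" using True l by (force simp: D_def)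
        then show "filterlim (\<lambda>N. (b N j - b N l) \<bullet> (y, 1)) at_top sequentially"
          using squash_limit_inner[OF c[OF jp l(1)] not_near[OF l(2) jp l(1)]] by simp
      qed
      then have "(\<lambda>N. 1 - (\<Sum>l\<in>{..<p} - cls j. soft_piece p (b N) l y)) \<longlonglongrightarrow> 1 - (\<Sum>l\<in>{..<p} - cls j. 0)"
        by (intro tendsto_intros)
      moreover have "1 - (\<Sum>l\<in>{..<p} - cls j. soft_piece p (b N) l y) = (\<Sum>k\<in>cls j. soft_piece p (b N) k y)" for N
      proof -
        have "cls j \<subseteq> {..<p}" by (auto simp: cls_def)
        then show ?thesis
          using sum.subset_diff[of "cls j" "{..<p}" "\<lambda>k. soft_piece p (b N) k y"] sum_soft_piece[OF p0, of "b N" y]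
          by simp
      qed
      ultimately show ?thesis using True by simp
    next
      case False
      then obtain l where l: "l < p" "\<not> near j l" "c j l \<bullet> (y, 1) < 0" by (auto simp: D_def not_le)
      then have "\<not> near l j" using near_sym[of l j] jp by blast
      then have lim: "filterlim (\<lambda>N. (b N l - b N j) \<bullet> (y, 1)) at_top sequentially"
        using l c_swap[OF jp l(1)] squash_limit_inner[OF c[OF l(1) jp] not_near[OF _ l(1) jp], of "(y, 1)"]
        by simp
      \<comment> \<open>Functions \<open>j\<close> and \<open>k\<close> differ at \<open>y\<close>
        by a bounded amount, so \<open>l\<close> beats \<open>k\<close> as well.\<close>
      have "(\<lambda>N. soft_piece p (b N) k y) \<longlonglongrightarrow> 0" if "k \<in> cls j" for k
      proof (rule small[OF _ l(1)])
        have "k < p" "near j k" using that by (auto simp: cls_def)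
        then obtain B where "\<forall>\<^sub>F N in sequentially. norm (b N j - b N k) \<le> B"
          using near_iff jp by blast
        then have "\<forall>\<^sub>F N in sequentially. - (B * norm (y, 1::real)) \<le> (b N j - b N k) \<bullet> (y, 1)"
        proof eventually_elim
          case (elim N)
          have "\<bar>(b N j - b N k) \<bullet> (y, 1)\<bar> \<le> norm (b N j - b N k) * norm (y, 1::real)"
            by (rule Cauchy_Schwarz_ineq2)
          also have "\<dots> \<le> B * norm (y, 1::real)" using elim by (rule mult_right_mono) simp
          finally show ?case by linarith
        qed
        then have "\<forall>\<^sub>F N in sequentially.
            - (B * norm (y, 1::real)) + (b N l - b N j) \<bullet> (y, 1) \<le> (b N l - b N k) \<bullet> (y, 1)"
          by eventually_elim (simp add: inner_diff_left)
        with filterlim_tendsto_add_at_top[OF tendsto_const lim]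
        show "filterlim (\<lambda>N. (b N l - b N k) \<bullet> (y, 1)) at_top sequentially"
          by (rule filterlim_at_top_mono)
      qed
      then have "(\<lambda>N. \<Sum>k\<in>cls j. soft_piece p (b N) k y) \<longlonglongrightarrow> (\<Sum>k\<in>cls j. 0)"
        by (intro tendsto_intros)
      then show ?thesis using False by simp
    qed
  qed
  have D_eq: "D j = (\<Inter>l\<in>{l. l < p \<and> \<not> near j l}. {y. - fst (c j l) \<bullet> y \<le> snd (c j l)})" for j
  proof -
    have "c j l \<bullet> (y, 1) \<ge> 0 \<longleftrightarrow> - fst (c j l) \<bullet> y \<le> snd (c j l)" for l y
      by (auto simp: inner_prod_def)
    then show ?thesis by (auto simp: D_def)
  qed
  have D_closed: "closed (D j)" for j
    unfolding D_eq by (intro closed_INT ballI closed_halfspace_le)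
  have D_convex: "convex (D j)" for j
    unfolding D_eq by (intro convex_INT convex_halfspace_le)
  \<comment> \<open>Off \<open>Z\<close> the class sums add up to 1, so their limits cannot all be
    0. The uncovered set is thus open and null, hence empty.\<close>
  have D_cover: "(\<Union>j\<in>J. D j) = UNIV"
  proof -
    have "y \<in> (\<Union>j\<in>J. D j)" if y: "y \<notin> Z" for y
    proof (rule ccontr)
      assume "\<not> ?thesis"
      then have "(\<lambda>N. \<Sum>k\<in>cls j. soft_piece p (b N) k y) \<longlonglongrightarrow> 0" if "j \<in> J" for j
        using limit[OF that y] that by simp
      then have "(\<lambda>N. \<Sum>j\<in>J. \<Sum>k\<in>cls j. soft_piece p (b N) k y) \<longlonglongrightarrow> (\<Sum>j\<in>J. 0)"
        by (intro tendsto_sum)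
      then show False by (simp add: sum_cls sum_soft_piece[OF p0] LIMSEQ_const_iff)
    qed
    then have "- (\<Union>j\<in>J. D j) \<subseteq> Z" by blast
    moreover have "open (- (\<Union>j\<in>J. D j))"
      using D_closed J(1) by (intro open_Compl closed_UN) auto
    ultimately have "- (\<Union>j\<in>J. D j) = {}" using open_subset_null_empty Z_null by blast
    then show ?thesis by blast
  qed
  have D_disj: "disjoint_family_on (\<lambda>j. interior (D j)) J"
    unfolding disjoint_family_on_def
  proof (intro ballI impI)
    fix j j' assume jj: "j \<in> J" "j' \<in> J" "j \<noteq> j'"
    then have p: "j < p" "j' < p" and far: "\<not> near j j'" "\<not> near j' j" using J J_far by auto
    have "D j \<inter> D j' \<subseteq> Z"
    proof
      fix y assume "y \<in> D j \<inter> D j'"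
      then have "c j j' \<bullet> (y, 1) \<ge> 0" "c j' j \<bullet> (y, 1) \<ge> 0" using far p by (auto simp: D_def)
      then have "c j j' \<bullet> (y, 1) = 0" using c_swap[OF p] by simp
      then show "y \<in> Z" using far p by (auto simp: Z_def)
    qed
    then have "interior (D j) \<inter> interior (D j') \<subseteq> Z" using interior_subset by blast
    then show "interior (D j) \<inter> interior (D j') = {}"
      using Z_null by (intro open_subset_null_empty) auto
  qed
  \<comment> \<open>Dominated convergence sends the integral of the class sum to the measure of
    \<open>D j\<close>, while \<open>b_int\<close> sends it to \<open>w j\<close> times
    \<open>M / real p\<close>.\<close>
  have D_measure: "measure (\<mu> i) (D j) = real (w j) * (M / real p)" if i: "i < DIM('a)" and j: "j \<in> J" for i j
  proof -
    note \<mu>i = \<mu>[OF i]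
    interpret finite_measure "\<mu> i" using \<mu>i by (simp add: tame_measure_def)
    have sets: "sets (\<mu> i) = sets borel" using \<mu>i by (simp add: tame_measure_def)
    have AE: "AE y in \<mu> i. y \<notin> Z"
      using \<mu>i Z_null unfolding tame_measure_def absolutely_continuous_def by (intro AE_not_in) auto
    have Dm: "D j \<in> sets (\<mu> i)" using D_closed sets by (simp add: borel_closed)
    have cls_p: "k < p" if "k \<in> cls j" for k using that by (simp add: cls_def)
    have "(\<lambda>N. LINT y|\<mu> i. (\<Sum>k\<in>cls j. soft_piece p (b N) k y)) \<longlonglongrightarrow> (LINT y|\<mu> i. indicator (D j) y)"
    proof (rule integral_dominated_convergence[where w = "\<lambda>_. 1"])
      show "AE y in \<mu> i. (\<lambda>N. \<Sum>k\<in>cls j. soft_piece p (b N) k y) \<longlonglongrightarrow> indicator (D j) y"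
        using AE by eventually_elim (rule limit[OF j])
      show "AE y in \<mu> i. norm (\<Sum>k\<in>cls j. soft_piece p (b N) k y) \<le> 1" for N
      proof (intro always_eventually allI)
        fix y
        have "(\<Sum>k\<in>cls j. soft_piece p (b N) k y) \<le> (\<Sum>k<p. soft_piece p (b N) k y)"
          using cls_p soft_piece_nonneg by (intro sum_mono2) auto
        then show "norm (\<Sum>k\<in>cls j. soft_piece p (b N) k y) \<le> 1"
          using sum_soft_piece[OF p0, of "b N" y] by (simp add: sum_nonneg soft_piece_nonneg)
      qed
    qed (use Dm borel_measurable_soft_piece[OF p0 sets] in auto)
    moreover have "(LINT y|\<mu> i. (\<Sum>k\<in>cls j. soft_piece p (b N) k y)) = (\<Sum>k\<in>cls j. LINT y|\<mu> i. soft_piece p (b N) k y)" for N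
      using integrable_soft_piece[OF \<mu>i] cls_p by (intro Bochner_Integration.integral_sum) auto
    moreover have "(\<lambda>N. \<Sum>k\<in>cls j. LINT y|\<mu> i. soft_piece p (b N) k y) \<longlonglongrightarrow> (\<Sum>k\<in>cls j. M / real p)"
      using b_int[OF i] cls_p by (intro tendsto_sum) auto
    ultimately have "(LINT y|\<mu> i. indicator (D j) y) = (\<Sum>k\<in>cls j. M / real p)"
      using LIMSEQ_unique by force
    moreover have "(LINT y|\<mu> i. indicator (D j) y) = measure (\<mu> i) (D j)"
      using Dm sets.sets_into_space[OF Dm] by (simp add: Int_absorb2)
    ultimately show ?thesis by (simp add: w_def)
  qed
  show ?thesis
    using J(1) D_closed D_convex w_pos w_less sum_w D_disj D_cover D_measure
    by (intro exI[of _ J] exI[of _ w] exI[of _ D]) blast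
qed

subsection \<open>The partition theorem\<close>

text \<open>Tame measures are closed under restriction, as the induction requires. Restriction by a
  density keeps the Borel sets of the whole space.\<close>

lemma tame_measure_restrict:
  fixes \<mu> :: "'a::euclidean_space measure"
  assumes "tame_measure \<mu>" "D \<in> sets borel"
  shows "tame_measure (density \<mu> (indicator D))"
    and "A \<in> sets borel \<Longrightarrow> measure (density \<mu> (indicator D)) A = measure \<mu> (D \<inter> A)"
proof -
  let ?\<nu> = "density \<mu> (indicator D)"
  have sets: "sets \<mu> = sets borel" using assms by (simp add: tame_measure_def)
  have D: "D \<in> sets \<mu>" using assms sets by simp
  interpret finite_measure \<mu> using assms by (simp add: tame_measure_def)
  have em: "emeasure ?\<nu> A = emeasure \<mu> (D \<inter> A)" if "A \<in> sets borel" for A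
    using that sets D by (simp add: emeasure_density nn_integral_indicator flip: indicator_inter_arith)
  then show "measure ?\<nu> A = measure \<mu> (D \<inter> A)" if "A \<in> sets borel" for A
    using that by (simp add: measure_def)
  have "finite_measure ?\<nu>"
    using em[of "space \<mu>"] sets.top[of \<mu>] sets by (intro finite_measureI) simp
  moreover have "absolutely_continuous lborel ?\<nu>"
  proof -
    have "absolutely_continuous \<mu> ?\<nu>"
      using D by (intro absolutely_continuousI_density) auto
    then show ?thesis
      using assms by (auto simp: tame_measure_def absolutely_continuous_def)
  qed
  moreover obtain B where "AE y in \<mu>. norm y \<le> B" using assms by (auto simp: tame_measure_def)
  then have "AE y in ?\<nu>. norm y \<le> B"
    using D by (subst AE_density) (auto elim: eventually_mono)
  ultimately show "tame_measure ?\<nu>"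
    using sets by (auto simp: tame_measure_def)
qed

text \<open>With \<open>k = p * m\<close>, piece \<open>D j\<close> has measure
  \<open>w j * m\<close>, which is less than \<open>k\<close> because \<open>w j < p\<close>. So the
  induction hypothesis applies to the restricted measures.\<close>

theorem convex_equipartition:
  fixes \<mu> :: "nat \<Rightarrow> 'a::euclidean_space measure"
  assumes "k \<ge> 1"
    and "\<And>i. i < DIM('a) \<Longrightarrow> tame_measure (\<mu> i)"
    and "\<And>i. i < DIM('a) \<Longrightarrow> measure (\<mu> i) UNIV = real k"
  shows "\<exists>C. (\<forall>j<k. closed (C j) \<and> convex (C j)) \<and> disjoint_family_on (\<lambda>j. interior (C j)) {..<k} \<and>
    (\<Union>j<k. C j) = UNIV \<and> (\<forall>i<DIM('a). \<forall>j<k. measure (\<mu> i) (C j) = 1)"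
  using assms
proof (induction k arbitrary: \<mu> rule: less_induct)
  case (less k)
  show ?case
  proof (cases "k = 1")
    case True
    then show ?thesis
      using less.prems by (intro exI[of _ "\<lambda>_. UNIV"]) (auto simp: disjoint_family_on_def)
  next
    case False
    then obtain p where p: "prime p" "p dvd k" using prime_factor_nat by blast
    then obtain m where m: "k = p * m" by auto
    have p0: "p > 0" using p prime_gt_0_nat by blast
    have m0: "m > 0" using m less.prems(1) by (cases m) auto
    have "\<exists>(J :: nat set) w D. finite J \<and> (\<forall>j\<in>J. closed (D j) \<and> convex (D j) \<and> 1 \<le> w j \<and> w j < p) \<and>
      (\<Sum>j\<in>J. w j) = p \<and> disjoint_family_on (\<lambda>j. interior (D j)) J \<and> (\<Union>j\<in>J. D j) = UNIV \<and>
      (\<forall>i<DIM('a). \<forall>j\<in>J. measure (\<mu> i) (D j) = real (w j) * (real k / real p))"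
      by (rule coarse_equipartition[OF p(1)]) (use less.prems in auto)
    then obtain J :: "nat set" and w D where J: "finite J"
      and Dw: "\<forall>j\<in>J. closed (D j) \<and> convex (D j) \<and> 1 \<le> w j \<and> w j < p"
      and sum_w: "(\<Sum>j\<in>J. w j) = p"
      and D_disj: "disjoint_family_on (\<lambda>j. interior (D j)) J" and D_cover: "(\<Union>j\<in>J. D j) = UNIV"
      and D_measure: "\<forall>i<DIM('a). \<forall>j\<in>J. measure (\<mu> i) (D j) = real (w j) * (real k / real p)"
      by (elim exE conjE) (rule that)
    have D: "closed (D j) \<and> convex (D j)" and w: "1 \<le> w j \<and> w j < p" if "j \<in> J" for j
      using Dw that by auto
    define P where "P j C \<longleftrightarrow> (\<forall>t<w j * m. closed (C t) \<and> convex (C t)) \<and>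
        disjoint_family_on (\<lambda>t. interior (C t)) {..<w j * m} \<and> (\<Union>t<w j * m. C t) = UNIV \<and>
        (\<forall>i<DIM('a). \<forall>t<w j * m. measure (density (\<mu> i) (indicator (D j))) (C t) = 1)" for j C
    have "\<exists>C. P j C" if j: "j \<in> J" for j
    unfolding P_def
    proof (rule less.IH)
      show "w j * m < k" using w[OF j] m m0 by simp
      show "1 \<le> w j * m" using w[OF j] m0 by simp
      show "tame_measure (density (\<mu> i) (indicator (D j)))" if "i < DIM('a)" for i
        using less.prems(2)[OF that] D[OF j] by (intro tame_measure_restrict) (auto simp: borel_closed)
      show "measure (density (\<mu> i) (indicator (D j))) UNIV = real (w j * m)" if "i < DIM('a)" for i
        using tame_measure_restrict(2)[OF less.prems(2)[OF that], of "D j" UNIV] D[OF j] D_measure that j p0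
        by (simp add: borel_closed m)
    qed
    then obtain E where "\<And>j. j \<in> J \<Longrightarrow> P j (E j)" by metis
    then have E: "\<And>j t. j \<in> J \<Longrightarrow> t < w j * m \<Longrightarrow> closed (E j t) \<and> convex (E j t)"
      and E_disj: "\<And>j. j \<in> J \<Longrightarrow> disjoint_family_on (\<lambda>t. interior (E j t)) {..<w j * m}"
      and E_cover: "\<And>j. j \<in> J \<Longrightarrow> (\<Union>t<w j * m. E j t) = UNIV"
      and E_measure: "\<And>i j t. j \<in> J \<Longrightarrow> i < DIM('a) \<Longrightarrow> t < w j * m \<Longrightarrow>
        measure (density (\<mu> i) (indicator (D j))) (E j t) = 1"
      unfolding P_def by simp_all
    \<comment> \<open>The pairs of a coarse piece and a piece of its subdivision number
      \<open>p * m = k\<close>, as the weights add up to \<open>p\<close>; \<open>h\<close>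
      enumerates them.\<close>
    define T where "T = (SIGMA j:J. {..<w j * m})"
    have "finite T" using J by (simp add: T_def)
    have "card T = (\<Sum>j\<in>J. w j) * m" using J by (simp add: T_def sum_distrib_right)
    then have "card {..<k} = card T" by (simp add: sum_w m)
    then obtain h where "bij_betw h {..<k} T"
      using finite_same_card_bij[of "{..<k}" T] \<open>finite T\<close> by auto
    then have h: "inj_on h {..<k}" "h ` {..<k} = T" by (auto simp: bij_betw_def)
    \<comment> \<open>The sets \<open>E j t\<close> partition the whole space, so they are cut down
      to \<open>D j\<close>.\<close>
    define C where "C q = (case h q of (j, t) \<Rightarrow> D j \<inter> E j t)" for q
    have hT: "\<exists>j t. h q = (j, t) \<and> j \<in> J \<and> t < w j * m" if "q < k" for q
    proof -
      have "h q \<in> T" using that h(2) by blast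
      then show ?thesis by (auto simp: T_def)
    qed
    have "closed (C q) \<and> convex (C q)" if "q < k" for q
      using hT[OF that] D E by (auto simp: C_def intro!: closed_Int convex_Int)
    moreover have "disjoint_family_on (\<lambda>q. interior (C q)) {..<k}"
      unfolding disjoint_family_on_def
    proof (intro ballI impI)
      fix q q' assume q: "q \<in> {..<k}" "q' \<in> {..<k}" "q \<noteq> q'"
      obtain j t where jt: "h q = (j, t)" "j \<in> J" "t < w j * m" using hT q by blast
      obtain j' t' where jt': "h q' = (j', t')" "j' \<in> J" "t' < w j' * m" using hT q by blast
      have "(j, t) \<noteq> (j', t')" using h(1) q jt(1) jt'(1) by (metis inj_onD)
      then consider "j \<noteq> j'" | "j = j'" "t \<noteq> t'" by auto
      then show "interior (C q) \<inter> interior (C q') = {}"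
      proof cases
        case 1
        then have "interior (D j) \<inter> interior (D j') = {}"
          using D_disj jt jt' by (auto simp: disjoint_family_on_def)
        then show ?thesis using jt jt' by (auto simp: C_def interior_Int)
      next
        case 2
        then have "interior (E j t) \<inter> interior (E j t') = {}"
          using E_disj[OF jt(2)] jt jt' by (auto simp: disjoint_family_on_def)
        then show ?thesis using jt jt' 2 by (auto simp: C_def interior_Int)
      qed
    qed
    moreover have "(\<Union>q<k. C q) = UNIV"
    proof -
      have "y \<in> (\<Union>q<k. C q)" for y
      proof -
        obtain j where j: "j \<in> J" "y \<in> D j" using D_cover by blast
        moreover obtain t where t: "t < w j * m" "y \<in> E j t" using E_cover[OF j(1)] by blast
        ultimately have "(j, t) \<in> h ` {..<k}" unfolding h(2) T_def by auto
        then obtain q where "q < k" "h q = (j, t)" by auto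
        then have "y \<in> C q" using j t by (simp add: C_def)
        with \<open>q < k\<close> show ?thesis by blast
      qed
      then show ?thesis by blast
    qed
    moreover have "measure (\<mu> i) (C q) = 1" if iq: "i < DIM('a)" "q < k" for i q
    proof -
      obtain j t where jt: "h q = (j, t)" "j \<in> J" "t < w j * m" using hT[OF iq(2)] by blast
      have "measure (\<mu> i) (D j \<inter> E j t) = measure (density (\<mu> i) (indicator (D j))) (E j t)"
        using tame_measure_restrict(2)[OF less.prems(2)[OF iq(1)], of "D j" "E j t"] D E jt
        by (simp add: borel_closed)
      then show ?thesis using E_measure[OF jt(2) iq(1) jt(3)] jt(1) by (simp add: C_def)
    qed
    ultimately show ?thesis by blast
  qed
qed

lemma nice_measure_tame:
  fixes \<mu> :: "(real ^ 'n) measure"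
  assumes "nice_measure \<mu>" "emeasure \<mu> UNIV \<noteq> 0"
  shows "tame_measure \<mu>"
proof -
  obtain K where \<mu>: "sets \<mu> = sets borel" "finite_measure \<mu>" "absolutely_continuous lborel \<mu>"
    and K: "bounded K" "emeasure \<mu> K = emeasure \<mu> UNIV"
    using assms(1) by (auto simp: nice_measure_def)
  interpret finite_measure \<mu> by fact
  have space: "space \<mu> = UNIV" using \<mu>(1) sets_eq_imp_space_eq by force
  \<comment> \<open>A set that is not measurable has \<open>emeasure\<close> 0 by default, but
    \<open>K\<close> carries the nonzero total mass.\<close>
  have "K \<in> sets \<mu>" using K(2) assms(2) emeasure_notin_sets by metis
  then have "emeasure \<mu> (UNIV - K) = 0"
    using emeasure_compl[of K \<mu>] K(2) by (simp add: space emeasure_eq_measure)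
  then have "AE y in \<mu>. y \<in> K"
    using \<open>K \<in> sets \<mu>\<close> sets.compl_sets[of K \<mu>] by (intro AE_I[of _ _ "UNIV - K"]) (auto simp: space)
  moreover obtain B where "\<And>y. y \<in> K \<Longrightarrow> norm y \<le> B" using K(1) by (auto simp: bounded_iff)
  ultimately have "AE y in \<mu>. norm y \<le> B" by (auto elim: eventually_mono)
  with \<mu> show ?thesis by (auto simp: tame_measure_def)
qed

theorem theorem1:
  fixes \<mu> :: "nat \<Rightarrow> (real ^ 'n) measure"
    and k :: nat
  assumes "k \<ge> 1"
    and "\<And>i. i \<in> {1..CARD('n)} \<Longrightarrow> nice_measure (\<mu> i)"
    and "\<And>i. i \<in> {1..CARD('n)} \<Longrightarrow> emeasure (\<mu> i) UNIV = of_nat k"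
  shows "\<exists>C :: nat \<Rightarrow> (real ^ 'n) set.
           convex_partition k C \<and>
           (\<forall>i\<in>{1..CARD('n)}. \<forall>j\<in>{1..k}. emeasure (\<mu> i) (C j) = 1)"
proof -
  \<comment> \<open>Measures and pieces are numbered from 1 in the theorem and from 0 in
    \<open>convex_equipartition\<close>.\<close>
  have tame: "tame_measure (\<mu> (Suc i))" if "i < DIM(real ^ 'n)" for i
    using assms that by (intro nice_measure_tame) auto
  have "measure (\<mu> (Suc i)) UNIV = real k" if "i < DIM(real ^ 'n)" for i
    using assms(3)[of "Suc i"] that by (simp add: measure_def)
  then obtain C :: "nat \<Rightarrow> (real ^ 'n) set" where C: "\<forall>j<k. closed (C j) \<and> convex (C j)"
    and disj: "disjoint_family_on (\<lambda>j. interior (C j)) {..<k}" and cover: "(\<Union>j<k. C j) = UNIV"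
    and one: "\<forall>i<DIM(real ^ 'n). \<forall>j<k. measure (\<mu> (Suc i)) (C j) = 1"
    using convex_equipartition[of k "\<lambda>i. \<mu> (Suc i)"] assms(1) tame by blast
  have "convex_partition k (\<lambda>j. C (j - 1))"
    unfolding convex_partition_def
  proof (intro conjI ballI)
    show "closed (C (j - 1))" "convex (C (j - 1))" if "j \<in> {1..k}" for j
      using C that by auto
    show "disjoint_family_on (\<lambda>j. interior (C (j - 1))) {1..k}"
      unfolding disjoint_family_on_def
    proof (intro ballI impI)
      fix j j' assume "j \<in> {1..k}" "j' \<in> {1..k}" "j \<noteq> j'"
      then have "j - 1 \<in> {..<k}" "j' - 1 \<in> {..<k}" "j - 1 \<noteq> j' - 1" by auto
      then show "interior (C (j - 1)) \<inter> interior (C (j' - 1)) = {}"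
        using disj unfolding disjoint_family_on_def by blast
    qed
    have "y \<in> (\<Union>j\<in>{1..k}. C (j - 1))" for y
    proof -
      obtain j where "j < k" "y \<in> C j" using cover by blast
      then show ?thesis by (intro UN_I[of "Suc j"]) auto
    qed
    then show "(\<Union>j\<in>{1..k}. C (j - 1)) = UNIV" by blast
  qed
  moreover have "emeasure (\<mu> i) (C (j - 1)) = 1" if i: "i \<in> {1..CARD('n)}" and j: "j \<in> {1..k}" for i j
  proof -
    interpret finite_measure "\<mu> i" using assms(2)[OF i] by (simp add: nice_measure_def)
    have "measure (\<mu> (Suc (i - 1))) (C (j - 1)) = 1"
      using one i j by (intro one[rule_format]) auto
    then show ?thesis using i by (simp add: emeasure_eq_measure)
  qed
  ultimately show ?thesis by blast
qed

end
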